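(* Let $R$ be a ring, $\lambda$ an infinite regular cardinal and $P$ a $\lambda$-pure-injective right $R$-module. Then any cosyzygy module in an injective coresolution of $P$ is $\lambda$-pure-injective as well.
   Context: Rings are associative with unit, not necessarily commutative; module means right $R$-module. An embedding of modules $M\subseteq N$ is $\lambda$-pure if each system of fewer than $\lambda$ $R$-linear equations with parameters in $M$ that has a solution in $N$ has a solution in $M$. A module $F$ is $\lambda$-pure-injective if it is injective relative to all $\lambda$-pure embeddings; equivalently, each system of $R$-linear equations with parameters in $F$ has a solution in $F$ provided that each of its subsystems of cardinality $<\lambda$ has one. Given an injective coresolution $0\to P\to E^0\to E^1\to E^2\to\cdots$ (an exact sequence with all $E^n$ injective), its cosyzygy modules are the images of the maps $E^n\to E^{n+1}$, $n\ge 0$. *)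

theory Defs
  imports "HOL-Algebra.Module" "HOL-Algebra.AbelCoset"
begin

unbundle cardinal_syntax

text \<open>
  Right modules over a not necessarily commutative ring. The library's locale \<^locale>\<open>module\<close>
  demands a commutative ring, so only its record type is reused: \<open>r \<odot>\<^bsub>M\<^esub> x\<close> stands for
  the product \<open>x r\<close> of the right module, whence the order of the factors in \<open>smult_assoc\<close>.
\<close>

locale right_module = R?: ring R + M?: abelian_group M
  for R :: "('r, 'c) ring_scheme" (structure) and M :: "('r, 'm) module" (structure) +
  assumes smult_closed:
      "\<lbrakk>r \<in> carrier R; x \<in> carrier M\<rbrakk> \<Longrightarrow> r \<odot>\<^bsub>M\<^esub> x \<in> carrier M"
    and smult_add_scalar:
      "\<lbrakk>r \<in> carrier R; s \<in> carrier R; x \<in> carrier M\<rbrakk> \<Longrightarrow>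
        (r \<oplus>\<^bsub>R\<^esub> s) \<odot>\<^bsub>M\<^esub> x = r \<odot>\<^bsub>M\<^esub> x \<oplus>\<^bsub>M\<^esub> s \<odot>\<^bsub>M\<^esub> x"
    and smult_add_vector:
      "\<lbrakk>r \<in> carrier R; x \<in> carrier M; y \<in> carrier M\<rbrakk> \<Longrightarrow>
        r \<odot>\<^bsub>M\<^esub> (x \<oplus>\<^bsub>M\<^esub> y) = r \<odot>\<^bsub>M\<^esub> x \<oplus>\<^bsub>M\<^esub> r \<odot>\<^bsub>M\<^esub> y"
    and smult_assoc:
      "\<lbrakk>r \<in> carrier R; s \<in> carrier R; x \<in> carrier M\<rbrakk> \<Longrightarrow>
        (r \<otimes>\<^bsub>R\<^esub> s) \<odot>\<^bsub>M\<^esub> x = s \<odot>\<^bsub>M\<^esub> (r \<odot>\<^bsub>M\<^esub> x)"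
    and smult_one:
      "x \<in> carrier M \<Longrightarrow> \<one>\<^bsub>R\<^esub> \<odot>\<^bsub>M\<^esub> x = x"

definition rmod_hom ::
  "('r, 'c) ring_scheme \<Rightarrow> ('r, 'm) module \<Rightarrow> ('r, 'n) module \<Rightarrow> ('m \<Rightarrow> 'n) set" where
  "rmod_hom R M N = {h \<in> hom (add_monoid M) (add_monoid N).
     \<forall>r \<in> carrier R. \<forall>x \<in> carrier M. h (r \<odot>\<^bsub>M\<^esub> x) = r \<odot>\<^bsub>N\<^esub> h x}"

definition restrict_carrier :: "('r, 'm) module \<Rightarrow> 'm set \<Rightarrow> ('r, 'm) module" where
  "restrict_carrier M H = M\<lparr>carrier := H\<rparr>"

text \<open>
  A linear equation \<open>\<Sum>\<^sub>i x\<^sub>i c\<^sub>i = m\<close> in unknowns \<open>x\<^sub>i\<close> named by the elements of a type \<open>'l\<close> is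
  the pair \<open>(c, m)\<close>, where \<open>c\<close> has finite support.
\<close>

type_synonym ('l, 'r, 'm) equation = "('l \<Rightarrow> 'r) \<times> 'm"

definition linear_equations ::
  "('r, 'c) ring_scheme \<Rightarrow> 'm set \<Rightarrow> ('l, 'r, 'm) equation set" where
  "linear_equations R H =
     {(c, m). range c \<subseteq> carrier R \<and> finite {i. c i \<noteq> \<zero>\<^bsub>R\<^esub>} \<and> m \<in> H}"

definition solvable_in ::
  "('r, 'c) ring_scheme \<Rightarrow> ('r, 'm) module \<Rightarrow> ('l, 'r, 'm) equation set \<Rightarrow> bool" where
  "solvable_in R M S \<longleftrightarrow>
     (\<exists>x :: 'l \<Rightarrow> 'm. range x \<subseteq> carrier M \<and>
        (\<forall>(c, m) \<in> S. (\<Oplus>\<^bsub>M\<^esub> i \<in> {i. c i \<noteq> \<zero>\<^bsub>R\<^esub>}. c i \<odot>\<^bsub>M\<^esub> x i) = m))"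

text \<open>
  Infinite cardinals are represented, as in the library, by cardinal orders \<open>\<kappa> :: 'l rel\<close>.
  A system of fewer than \<open>\<kappa>\<close> equations involves fewer than \<open>\<kappa>\<close> unknowns (finitely many if
  \<open>\<kappa>\<close> is countable), so it is no restriction to name the unknowns by elements of \<open>'l\<close>.
\<close>

definition pure_submodule ::
  "'l rel \<Rightarrow> 'm set \<Rightarrow> ('r, 'c) ring_scheme \<Rightarrow> ('r, 'm) module \<Rightarrow> bool" where
  "pure_submodule \<kappa> H R M \<longleftrightarrow> submodule H R M \<and>
     (\<forall>S :: ('l, 'r, 'm) equation set.
        S \<subseteq> linear_equations R H \<and> |S| <o \<kappa> \<and> solvable_in R M S \<longrightarrow>
        solvable_in R (restrict_carrier M H) S)"

definition extends_homs ::
  "('r, 'c) ring_scheme \<Rightarrow> ('r, 'f) module \<Rightarrow> 'v set \<Rightarrow> ('r, 'v) module \<Rightarrow> bool" where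
  "extends_homs R F H M \<longleftrightarrow>
     (\<forall>f \<in> rmod_hom R (restrict_carrier M H) F. \<exists>g \<in> rmod_hom R M F. \<forall>x \<in> H. g x = f x)"

text \<open>
  HOL cannot quantify over types inside a formula, so the type \<open>'v\<close> on which the test modules
  live is a parameter. Being injective, or \<open>\<kappa>\<close>-pure-injective, in the usual sense means being
  so for every \<open>'v\<close>; the condition for \<open>'v\<close> implies that for all types embeddable into \<open>'v\<close>.
\<close>

definition injective_module ::
  "'v itself \<Rightarrow> ('r, 'c) ring_scheme \<Rightarrow> ('r, 'f) module \<Rightarrow> bool" where
  "injective_module _ R F \<longleftrightarrow> right_module R F \<and>
     (\<forall>(M :: ('r, 'v) module) H. right_module R M \<and> submodule H R M \<longrightarrow> extends_homs R F H M)"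

definition pure_injective_module ::
  "'v itself \<Rightarrow> 'l rel \<Rightarrow> ('r, 'c) ring_scheme \<Rightarrow> ('r, 'f) module \<Rightarrow> bool" where
  "pure_injective_module _ \<kappa> R F \<longleftrightarrow> right_module R F \<and>
     (\<forall>(M :: ('r, 'v) module) H. right_module R M \<and> pure_submodule \<kappa> H R M \<longrightarrow>
        extends_homs R F H M)"

text \<open>The exact sequence \<open>0 \<rightarrow> P \<rightarrow> E 0 \<rightarrow> E 1 \<rightarrow> \<dots>\<close> with augmentation \<open>\<iota>\<close> and differentials \<open>d n\<close>.\<close>

definition injective_coresolution ::
  "'v itself \<Rightarrow> ('r, 'c) ring_scheme \<Rightarrow> ('r, 'p) module \<Rightarrow> ('p \<Rightarrow> 'e) \<Rightarrow>
     (nat \<Rightarrow> ('r, 'e) module) \<Rightarrow> (nat \<Rightarrow> 'e \<Rightarrow> 'e) \<Rightarrow> bool" where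
  "injective_coresolution V R P \<iota> E d \<longleftrightarrow>
     right_module R P \<and> (\<forall>n. injective_module V R (E n)) \<and>
     \<iota> \<in> rmod_hom R P (E 0) \<and> (\<forall>n. d n \<in> rmod_hom R (E n) (E (Suc n))) \<and>
     inj_on \<iota> (carrier P) \<and>
     \<iota> ` carrier P = a_kernel (E 0) (E 1) (d 0) \<and>
     (\<forall>n. d n ` carrier (E n) = a_kernel (E (Suc n)) (E (Suc (Suc n))) (d (Suc n)))"

definition cosyzygy :: "(nat \<Rightarrow> ('r, 'e) module) \<Rightarrow> (nat \<Rightarrow> 'e \<Rightarrow> 'e) \<Rightarrow> nat \<Rightarrow> ('r, 'e) module" where
  "cosyzygy E d n = restrict_carrier (E (Suc n)) (d n ` carrier (E n))"

text \<open>
  A type large enough to accommodate the modules needed to test a condition over a ring on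
  \<open>'r\<close>, for modules on \<open>'e\<close>, against all modules on \<open>'u\<close>: it is infinite and \<open>'u\<close>, \<open>'r\<close>, \<open>'e\<close>
  embed into it.
\<close>

type_synonym ('u, 'r, 'e) test_type = "('u + 'r + 'e) list"

end

theory Submission
  imports Defs "HOL-Algebra.Free_Abelian_Groups"
begin

text \<open>
  It suffices to treat one step: if \<open>P\<close> is \<open>\<kappa>\<close>-pure-injective, \<open>E\<close> is injective and
  \<open>0 \<rightarrow> P \<rightarrow> E \<rightarrow> Q \<rightarrow> 0\<close> is exact, then \<open>Q\<close> is \<open>\<kappa>\<close>-pure-injective. A homomorphism from a \<open>\<kappa>\<close>-pure
  submodule \<open>H\<close> of \<open>M\<close> to \<open>Q\<close> determines a class in \<open>Ext\<^sup>1(H, P)\<close>. If this class lifts to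
  \<open>Ext\<^sup>1(M, P)\<close>, then the homomorphism extends to \<open>M\<close> up to one that factors through \<open>E\<close>, and the
  latter extends because \<open>E\<close> is injective. So what is needed is that
  \<open>Ext\<^sup>1(M, P) \<rightarrow> Ext\<^sup>1(H, P)\<close> is surjective.

  Present \<open>M\<close> by the free module on the set of all its elements, with kernel \<open>K(M)\<close>, and \<open>H\<close>
  likewise. Then \<open>Ext\<^sup>1(M, P)\<close> is a quotient of \<open>Hom(K(M), P)\<close>, so it is enough to extend
  homomorphisms from \<open>K(H)\<close> to \<open>P\<close> to all of \<open>K(M)\<close>. The key point, \<open>pure_submodule_relations\<close>, is
  that \<open>K(H)\<close> is \<open>\<kappa>\<close>-pure in \<open>K(M)\<close>; then pure-injectivity of \<open>P\<close> applies. For this it matters that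
  the presentations are functorial: a system of fewer than \<open>\<kappa>\<close> equations over \<open>K(H)\<close> solved in
  \<open>K(M)\<close> involves fewer than \<open>\<kappa>\<close> elements of \<open>M\<close>, and purity of \<open>H\<close>
  provides a substitution of elements of \<open>H\<close> for them that preserves the relations in question
  and fixes the elements that are already in \<open>H\<close>. The lemma \<open>pure_injective_cokernel\<close> carries out the argument with explicit homomorphisms instead of
  \<open>Ext\<close> groups.

  There remains a question of size. To test \<open>Q\<close> against modules on a type \<open>'v\<close>, one has to test \<open>P\<close>
  and \<open>E\<close> against submodules of the free module on a set of elements of \<open>'v\<close>. For infinite \<open>'v\<close> into
  which the ring embeds, that free module again embeds into \<open>'v\<close> (\<open>finite_support_code\<close>), and
  modules can be transported along injections. So the induction on the cosyzygies can be run with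
  one such type, and only the final result is specialised to a smaller one.
\<close>

section \<open>Homomorphisms and submodules\<close>

lemma rmod_homI:
  assumes "\<And>x. x \<in> carrier M \<Longrightarrow> h x \<in> carrier N"
    and "\<And>x y. \<lbrakk>x \<in> carrier M; y \<in> carrier M\<rbrakk> \<Longrightarrow> h (x \<oplus>\<^bsub>M\<^esub> y) = h x \<oplus>\<^bsub>N\<^esub> h y"
    and "\<And>r x. \<lbrakk>r \<in> carrier R; x \<in> carrier M\<rbrakk> \<Longrightarrow> h (r \<odot>\<^bsub>M\<^esub> x) = r \<odot>\<^bsub>N\<^esub> h x"
  shows "h \<in> rmod_hom R M N"
  using assms by (auto simp: rmod_hom_def hom_def)

lemma rmod_homD:
  assumes "h \<in> rmod_hom R M N"
  shows rmod_hom_closed: "x \<in> carrier M \<Longrightarrow> h x \<in> carrier N"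
    and rmod_hom_add: "\<lbrakk>x \<in> carrier M; y \<in> carrier M\<rbrakk> \<Longrightarrow> h (x \<oplus>\<^bsub>M\<^esub> y) = h x \<oplus>\<^bsub>N\<^esub> h y"
    and rmod_hom_smult: "\<lbrakk>r \<in> carrier R; x \<in> carrier M\<rbrakk> \<Longrightarrow> h (r \<odot>\<^bsub>M\<^esub> x) = r \<odot>\<^bsub>N\<^esub> h x"
    and rmod_hom_hom: "h \<in> hom (add_monoid M) (add_monoid N)"
  using assms by (auto simp: rmod_hom_def hom_def)

lemma rmod_hom_comp:
  "\<lbrakk>f \<in> rmod_hom R M N; g \<in> rmod_hom R N L\<rbrakk> \<Longrightarrow> (\<lambda>x. g (f x)) \<in> rmod_hom R M L"
  by (rule rmod_homI) (simp_all add: rmod_homD)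

lemma additive_zero:
  assumes "abelian_group M" "abelian_group N" "h \<in> hom (add_monoid M) (add_monoid N)"
  shows "h \<zero>\<^bsub>M\<^esub> = \<zero>\<^bsub>N\<^esub>"
  using group_hom.hom_one[of "add_monoid M" "add_monoid N" h] assms
  by (simp add: group_hom_def group_hom_axioms_def abelian_group.a_group)

text \<open>
  Stated for additive maps rather than module homomorphisms, since multiplication by a scalar of a
  noncommutative ring is only additive.
\<close>
lemma additive_finsum:
  assumes "abelian_group M" "abelian_group N" "h \<in> hom (add_monoid M) (add_monoid N)"
    and "g \<in> A \<rightarrow> carrier M"
  shows "h (finsum M g A) = finsum N (\<lambda>i. h (g i)) A"
proof -
  interpret M: abelian_group M by fact
  interpret N: abelian_group N by fact
  have closed: "x \<in> carrier M \<Longrightarrow> h x \<in> carrier N" for x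
    using assms(3) by (auto simp: hom_def)
  have add: "\<lbrakk>x \<in> carrier M; y \<in> carrier M\<rbrakk> \<Longrightarrow> h (x \<oplus>\<^bsub>M\<^esub> y) = h x \<oplus>\<^bsub>N\<^esub> h y" for x y
    using assms(3) by (auto simp: hom_def)
  show ?thesis
    using assms(4)
  proof (induction A rule: infinite_finite_induct)
    case (insert a A)
    then have "g a \<in> carrier M" "g \<in> A \<rightarrow> carrier M"
      "(\<lambda>i. h (g i)) \<in> A \<rightarrow> carrier N" "h (g a) \<in> carrier N"
      by (auto simp: closed Pi_iff)
    with insert show ?case by (simp add: add)
  qed (simp_all add: additive_zero[OF assms(1-3)])
qed

context right_module
begin

lemma smult_zero_vector:
  assumes "r \<in> carrier R"
  shows "r \<odot>\<^bsub>M\<^esub> \<zero>\<^bsub>M\<^esub> = \<zero>\<^bsub>M\<^esub>"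
  by (rule additive_zero) (use assms in \<open>auto simp: hom_def smult_closed smult_add_vector M.abelian_group_axioms\<close>)

lemma smult_zero_scalar:
  assumes "x \<in> carrier M"
  shows "\<zero>\<^bsub>R\<^esub> \<odot>\<^bsub>M\<^esub> x = \<zero>\<^bsub>M\<^esub>"
  by (rule additive_zero[of R M "\<lambda>r. r \<odot>\<^bsub>M\<^esub> x"])
    (use assms in \<open>auto simp: hom_def smult_closed smult_add_scalar M.abelian_group_axioms R.abelian_group_axioms\<close>)

text \<open>This makes closure under negation a consequence of closure under scalars.\<close>
lemma minus_one_smult:
  assumes "x \<in> carrier M"
  shows "(\<ominus>\<^bsub>R\<^esub> \<one>\<^bsub>R\<^esub>) \<odot>\<^bsub>M\<^esub> x = \<ominus>\<^bsub>M\<^esub> x"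
proof -
  have "(\<ominus>\<^bsub>R\<^esub> \<one>\<^bsub>R\<^esub>) \<odot>\<^bsub>M\<^esub> x \<oplus>\<^bsub>M\<^esub> x = (\<ominus>\<^bsub>R\<^esub> \<one>\<^bsub>R\<^esub> \<oplus>\<^bsub>R\<^esub> \<one>\<^bsub>R\<^esub>) \<odot>\<^bsub>M\<^esub> x"
    using assms by (simp add: smult_add_scalar smult_one)
  also have "\<dots> = \<zero>\<^bsub>M\<^esub>"
    using assms by (simp add: R.l_neg smult_zero_scalar)
  finally show ?thesis
    using assms by (intro M.minus_equality[symmetric]) (auto intro: smult_closed)
qed

lemma submoduleI:
  assumes "H \<subseteq> carrier M" "\<zero>\<^bsub>M\<^esub> \<in> H"
    and "\<And>x y. \<lbrakk>x \<in> H; y \<in> H\<rbrakk> \<Longrightarrow> x \<oplus>\<^bsub>M\<^esub> y \<in> H"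
    and smult: "\<And>r x. \<lbrakk>r \<in> carrier R; x \<in> H\<rbrakk> \<Longrightarrow> r \<odot>\<^bsub>M\<^esub> x \<in> H"
  shows "submodule H R M"
proof -
  have "\<ominus>\<^bsub>M\<^esub> x \<in> H" if "x \<in> H" for x
    using smult[of "\<ominus>\<^bsub>R\<^esub> \<one>\<^bsub>R\<^esub>" x] that assms(1) by (auto simp: minus_one_smult)
  then show ?thesis
    using assms by (intro submodule.intro subgroup.intro) (auto simp: submodule_axioms_def a_inv_def)
qed

lemma submoduleD:
  assumes "submodule H R M"
  shows "H \<subseteq> carrier M" "\<zero>\<^bsub>M\<^esub> \<in> H"
    and "\<lbrakk>x \<in> H; y \<in> H\<rbrakk> \<Longrightarrow> x \<oplus>\<^bsub>M\<^esub> y \<in> H"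
    and "\<lbrakk>r \<in> carrier R; x \<in> H\<rbrakk> \<Longrightarrow> r \<odot>\<^bsub>M\<^esub> x \<in> H"
  using subgroup.subset[OF submodule.axioms(1)[OF assms]]
    subgroup.one_closed[OF submodule.axioms(1)[OF assms]]
    subgroup.m_closed[OF submodule.axioms(1)[OF assms]]
    submodule.smult_closed[OF assms] by auto

lemma right_module_submodule:
  assumes "submodule H R M"
  shows "right_module R (restrict_carrier M H)"
proof -
  note sub = submoduleD[OF assms]
  have grp: "abelian_group (restrict_carrier M H)"
  proof (rule abelian_groupI)
    fix x assume "x \<in> carrier (restrict_carrier M H)"
    then show "\<exists>y \<in> carrier (restrict_carrier M H).
        y \<oplus>\<^bsub>restrict_carrier M H\<^esub> x = \<zero>\<^bsub>restrict_carrier M H\<^esub>"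
      using sub sub(4)[of "\<ominus>\<^bsub>R\<^esub> \<one>\<^bsub>R\<^esub>" x] by (auto simp: restrict_carrier_def minus_one_smult M.l_neg subset_iff
          intro!: bexI[of _ "\<ominus>\<^bsub>M\<^esub> x"])
  qed (use sub in \<open>auto simp: restrict_carrier_def M.a_ac subset_iff\<close>)
  show ?thesis
    using grp sub
    by (auto simp: right_module_def right_module_axioms_def restrict_carrier_def R.ring_axioms subset_iff
        smult_add_scalar smult_add_vector smult_assoc smult_one)
qed

end

lemma restrict_carrier_simps [simp]:
  "carrier (restrict_carrier M H) = H"
  "\<zero>\<^bsub>restrict_carrier M H\<^esub> = \<zero>\<^bsub>M\<^esub>"
  "x \<oplus>\<^bsub>restrict_carrier M H\<^esub> y = x \<oplus>\<^bsub>M\<^esub> y"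
  "r \<odot>\<^bsub>restrict_carrier M H\<^esub> x = r \<odot>\<^bsub>M\<^esub> x"
  "restrict_carrier (restrict_carrier M K) H = restrict_carrier M H"
  by (simp_all add: restrict_carrier_def)

lemma rmod_hom_restrict:
  assumes "h \<in> rmod_hom R M N" "H \<subseteq> carrier M"
  shows "h \<in> rmod_hom R (restrict_carrier M H) N"
  using assms by (auto intro!: rmod_homI simp: rmod_homD subset_iff)

lemma rmod_hom_corestrict:
  assumes "h \<in> rmod_hom R M N" "h ` carrier M \<subseteq> K"
  shows "h \<in> rmod_hom R M (restrict_carrier N K)"
  using assms by (auto intro!: rmod_homI simp: rmod_homD subset_iff)

lemma inclusion_rmod_hom:
  assumes "H \<subseteq> carrier M"
  shows "(\<lambda>x. x) \<in> rmod_hom R (restrict_carrier M H) M"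
  using assms by (auto intro!: rmod_homI)

lemma submodule_restrict_iff:
  assumes "right_module R M" "submodule K R M" "H \<subseteq> K"
  shows "submodule H R (restrict_carrier M K) \<longleftrightarrow> submodule H R M"
proof -
  interpret M: right_module R M by fact
  interpret K: right_module R "restrict_carrier M K"
    by (rule M.right_module_submodule[OF assms(2)])
  show ?thesis
    using assms(3) M.submoduleD(1)[OF assms(2)] M.submoduleD[of H] K.submoduleD[of H]
    by (intro iffI M.submoduleI K.submoduleI) auto
qed

section \<open>Free modules and linear combinations\<close>

definition lin_comb ::
  "('r, 'c) ring_scheme \<Rightarrow> ('r, 'm) module \<Rightarrow> ('b \<Rightarrow> 'm) \<Rightarrow> ('b \<Rightarrow> 'r) \<Rightarrow> 'm" where
  "lin_comb R M e c = (\<Oplus>\<^bsub>M\<^esub> i \<in> {i. c i \<noteq> \<zero>\<^bsub>R\<^esub>}. c i \<odot>\<^bsub>M\<^esub> e i)"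

lemma solvable_inI:
  assumes "\<And>i. x i \<in> carrier M" and "\<And>c m. (c, m) \<in> S \<Longrightarrow> lin_comb R M x c = m"
  shows "solvable_in R M S"
  unfolding solvable_in_def lin_comb_def[symmetric]
  by (rule exI[of _ x]) (use assms in auto)

lemma solvable_inE:
  assumes "solvable_in R M S"
  obtains x where "\<And>i. x i \<in> carrier M" "\<And>c m. (c, m) \<in> S \<Longrightarrow> lin_comb R M x c = m"
proof -
  from assms obtain x where x: "range x \<subseteq> carrier M" "\<forall>(c, m) \<in> S. lin_comb R M x c = m"
    unfolding solvable_in_def lin_comb_def[symmetric] by (elim exE conjE)
  show thesis
    by (rule that[of x]) (use x in auto)
qed

text \<open>
  The coefficients are multiplied by scalars from the right, as befits a right module. The two
  multiplicative fields of the record have no meaning for a module. The elements of the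
  free module on all of a type are exactly the left-hand sides of linear equations whose unknowns
  are named by that type; a system over a module is thus a set of pairs of an element of a free
  module and an element of the module.
\<close>
definition free_module :: "('r, 'c) ring_scheme \<Rightarrow> 'b set \<Rightarrow> ('r, 'b \<Rightarrow> 'r) module" where
  "free_module R X = \<lparr>
     carrier = {c. range c \<subseteq> carrier R \<and> finite {i. c i \<noteq> \<zero>\<^bsub>R\<^esub>} \<and> {i. c i \<noteq> \<zero>\<^bsub>R\<^esub>} \<subseteq> X},
     mult = undefined, one = undefined,
     ring.zero = (\<lambda>_. \<zero>\<^bsub>R\<^esub>), add = (\<lambda>c c' i. c i \<oplus>\<^bsub>R\<^esub> c' i),
     smult = (\<lambda>r c i. c i \<otimes>\<^bsub>R\<^esub> r)\<rparr>"

definition free_basis :: "('r, 'c) ring_scheme \<Rightarrow> 'b \<Rightarrow> 'b \<Rightarrow> 'r" where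
  "free_basis R b = (\<lambda>i. if i = b then \<one>\<^bsub>R\<^esub> else \<zero>\<^bsub>R\<^esub>)"

lemma free_module_simps [simp]:
  "\<zero>\<^bsub>free_module R X\<^esub> = (\<lambda>_. \<zero>\<^bsub>R\<^esub>)"
  "c \<oplus>\<^bsub>free_module R X\<^esub> c' = (\<lambda>i. c i \<oplus>\<^bsub>R\<^esub> c' i)"
  "r \<odot>\<^bsub>free_module R X\<^esub> c = (\<lambda>i. c i \<otimes>\<^bsub>R\<^esub> r)"
  by (simp_all add: free_module_def)

lemma mem_free_module:
  "c \<in> carrier (free_module R X) \<longleftrightarrow>
     (\<forall>i. c i \<in> carrier R) \<and> finite {i. c i \<noteq> \<zero>\<^bsub>R\<^esub>} \<and> (\<forall>i. c i \<noteq> \<zero>\<^bsub>R\<^esub> \<longrightarrow> i \<in> X)"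
  by (auto simp: free_module_def)

lemma free_module_mono: "X \<subseteq> Y \<Longrightarrow> carrier (free_module R X) \<subseteq> carrier (free_module R Y)"
  by (rule subsetI) (simp add: mem_free_module subset_eq)

lemma restrict_free_module:
  "restrict_carrier (free_module R Y) (carrier (free_module R X)) = free_module R X"
  by (simp add: restrict_carrier_def free_module_def)

lemma linear_equations_free:
  "linear_equations R H = {(c, m). c \<in> carrier (free_module R UNIV) \<and> m \<in> H}"
  by (auto simp: linear_equations_def mem_free_module)

context ring
begin

lemma free_basis_mem: "b \<in> X \<Longrightarrow> free_basis R b \<in> carrier (free_module R X)"
  by (auto simp: mem_free_module free_basis_def intro: finite_subset[of _ "{b}"])

lemma right_module_free: "right_module R (free_module R X)"
proof -
  let ?F = "free_module R X"
  have closed: "c \<oplus>\<^bsub>?F\<^esub> c' \<in> carrier ?F" if "c \<in> carrier ?F" "c' \<in> carrier ?F" for c c'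
  proof -
    have "finite {i. c i \<oplus> c' i \<noteq> \<zero>}"
      by (rule finite_subset[of _ "{i. c i \<noteq> \<zero>} \<union> {i. c' i \<noteq> \<zero>}"])
        (use that in \<open>auto simp: mem_free_module\<close>)
    then show ?thesis
      using that l_zero r_zero by (auto simp: mem_free_module) (metis l_zero zero_closed)
  qed
  have smult: "r \<odot>\<^bsub>?F\<^esub> c \<in> carrier ?F" if "c \<in> carrier ?F" "r \<in> carrier R" for c r
  proof -
    have "c i \<noteq> \<zero>" if "c i \<otimes> r \<noteq> \<zero>" for i
      using that \<open>r \<in> carrier R\<close> by (auto simp: l_null)
    moreover from this have "finite {i. c i \<otimes> r \<noteq> \<zero>}"
      using that by (intro finite_subset[of "{i. c i \<otimes> r \<noteq> \<zero>}" "{i. c i \<noteq> \<zero>}"])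
        (auto simp: mem_free_module)
    ultimately show ?thesis
      using that by (simp add: mem_free_module)
  qed
  have "abelian_group ?F"
  proof (rule abelian_groupI)
    fix c assume "c \<in> carrier ?F"
    then show "\<exists>c' \<in> carrier ?F. c' \<oplus>\<^bsub>?F\<^esub> c = \<zero>\<^bsub>?F\<^esub>"
      using smult[of c "\<ominus> \<one>"]
      by (intro bexI[of _ "(\<ominus> \<one>) \<odot>\<^bsub>?F\<^esub> c"]) (auto simp: mem_free_module r_minus l_neg)
  next
    fix c c' assume "c \<in> carrier ?F" "c' \<in> carrier ?F"
    then show "c \<oplus>\<^bsub>?F\<^esub> c' \<in> carrier ?F" by (rule closed)
  qed (auto simp: mem_free_module a_ac)
  moreover have "right_module_axioms R ?F"
  proof
    fix r c assume "r \<in> carrier R" "c \<in> carrier ?F"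
    then show "r \<odot>\<^bsub>?F\<^esub> c \<in> carrier ?F" using smult by blast
  qed (simp_all add: mem_free_module r_distr l_distr m_assoc)
  ultimately show ?thesis
    using ring_axioms by (simp add: right_module_def)
qed

end

text \<open>
  Supports vary with the coefficients, so two linear combinations are compared over a common
  finite index set.
\<close>
lemma (in right_module) lin_comb_superset:
  assumes "c \<in> carrier (free_module R X)" "e \<in> X \<rightarrow> carrier M"
    and "finite A" "{i. c i \<noteq> \<zero>\<^bsub>R\<^esub>} \<subseteq> A" "A \<subseteq> X"
  shows "lin_comb R M e c = (\<Oplus>\<^bsub>M\<^esub> i \<in> A. c i \<odot>\<^bsub>M\<^esub> e i)"
  unfolding lin_comb_def
  by (rule M.add.finprod_mono_neutral_cong_left)
    (use assms in \<open>auto simp: mem_free_module Pi_iff subset_iff intro!: smult_zero_scalar smult_closed\<close>)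

lemma (in right_module) lin_comb_closed:
  assumes "c \<in> carrier (free_module R X)" "e \<in> X \<rightarrow> carrier M"
  shows "lin_comb R M e c \<in> carrier M"
  unfolding lin_comb_def
  using assms by (intro M.finsum_closed) (auto simp: mem_free_module intro!: smult_closed)

text \<open>
  The universal property of the free module: a family of elements of a module extends linearly.
\<close>
lemma (in right_module) lin_comb_rmod_hom:
  assumes e: "e \<in> X \<rightarrow> carrier M"
  shows "lin_comb R M e \<in> rmod_hom R (free_module R X) M"
proof (rule rmod_homI)
  fix c c'
  assume c: "c \<in> carrier (free_module R X)" "c' \<in> carrier (free_module R X)"
  let ?A = "{i. c i \<noteq> \<zero>\<^bsub>R\<^esub>} \<union> {i. c' i \<noteq> \<zero>\<^bsub>R\<^esub>}"
  have A: "finite ?A" "?A \<subseteq> X" using c by (auto simp: mem_free_module)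
  interpret F: right_module R "free_module R X" by (rule R.right_module_free)
  have cc: "c \<oplus>\<^bsub>free_module R X\<^esub> c' \<in> carrier (free_module R X)" using c by (rule F.a_closed)
  have "lin_comb R M e (c \<oplus>\<^bsub>free_module R X\<^esub> c') = (\<Oplus>\<^bsub>M\<^esub> i \<in> ?A. (c i \<oplus>\<^bsub>R\<^esub> c' i) \<odot>\<^bsub>M\<^esub> e i)"
    by (subst lin_comb_superset[OF cc e A(1) _ A(2)]) auto
  also have "\<dots> = (\<Oplus>\<^bsub>M\<^esub> i \<in> ?A. c i \<odot>\<^bsub>M\<^esub> e i \<oplus>\<^bsub>M\<^esub> c' i \<odot>\<^bsub>M\<^esub> e i)"
    by (rule M.finsum_cong')
      (use c A e in \<open>auto simp: mem_free_module Pi_iff intro!: smult_add_scalar smult_closed\<close>)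
  also have "\<dots> = (\<Oplus>\<^bsub>M\<^esub> i \<in> ?A. c i \<odot>\<^bsub>M\<^esub> e i) \<oplus>\<^bsub>M\<^esub> (\<Oplus>\<^bsub>M\<^esub> i \<in> ?A. c' i \<odot>\<^bsub>M\<^esub> e i)"
    by (rule M.finsum_addf) (use c A e in \<open>auto simp: mem_free_module Pi_iff intro!: smult_closed\<close>)
  also have "\<dots> = lin_comb R M e c \<oplus>\<^bsub>M\<^esub> lin_comb R M e c'"
    using lin_comb_superset[OF c(1) e A(1) _ A(2)] lin_comb_superset[OF c(2) e A(1) _ A(2)] by auto
  finally show "lin_comb R M e (c \<oplus>\<^bsub>free_module R X\<^esub> c') = lin_comb R M e c \<oplus>\<^bsub>M\<^esub> lin_comb R M e c'" .
next
  fix r c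
  assume c: "r \<in> carrier R" "c \<in> carrier (free_module R X)"
  let ?A = "{i. c i \<noteq> \<zero>\<^bsub>R\<^esub>}"
  interpret F: right_module R "free_module R X" by (rule R.right_module_free)
  have rc: "r \<odot>\<^bsub>free_module R X\<^esub> c \<in> carrier (free_module R X)" using c by (rule F.smult_closed)
  have A: "finite ?A" "?A \<subseteq> X" using c by (auto simp: mem_free_module)
  have "lin_comb R M e (r \<odot>\<^bsub>free_module R X\<^esub> c) = (\<Oplus>\<^bsub>M\<^esub> i \<in> ?A. (c i \<otimes>\<^bsub>R\<^esub> r) \<odot>\<^bsub>M\<^esub> e i)"
    by (subst lin_comb_superset[OF rc e A(1) _ A(2)]) (use c in auto)
  also have "\<dots> = (\<Oplus>\<^bsub>M\<^esub> i \<in> ?A. r \<odot>\<^bsub>M\<^esub> (c i \<odot>\<^bsub>M\<^esub> e i))"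
    by (rule M.finsum_cong')
      (use c A e in \<open>auto simp: mem_free_module Pi_iff intro!: smult_assoc smult_closed\<close>)
  also have "\<dots> = r \<odot>\<^bsub>M\<^esub> lin_comb R M e c"
    unfolding lin_comb_def
    by (rule additive_finsum[symmetric])
      (use c A e in \<open>auto simp: mem_free_module Pi_iff hom_def smult_add_vector M.abelian_group_axioms intro!: smult_closed\<close>)
  finally show "lin_comb R M e (r \<odot>\<^bsub>free_module R X\<^esub> c) = r \<odot>\<^bsub>M\<^esub> lin_comb R M e c" .
qed (rule lin_comb_closed[OF _ e])

lemma (in right_module) lin_comb_basis:
  assumes "e b \<in> carrier M"
  shows "lin_comb R M e (free_basis R b) = e b"
proof -
  have "lin_comb R M e (free_basis R b) = (\<Oplus>\<^bsub>M\<^esub> i \<in> {b}. free_basis R b i \<odot>\<^bsub>M\<^esub> e i)"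
    by (rule lin_comb_superset[of _ "{b}", OF R.free_basis_mem])
      (use assms in \<open>auto simp: free_basis_def\<close>)
  also have "\<dots> = e b"
    using assms by (simp add: M.finsum_insert free_basis_def smult_one)
  finally show ?thesis .
qed

lemma rmod_hom_lin_comb:
  assumes "right_module R M" "right_module R N" "h \<in> rmod_hom R M N"
    and c: "c \<in> carrier (free_module R X)" and e: "e \<in> X \<rightarrow> carrier M"
  shows "h (lin_comb R M e c) = lin_comb R N (\<lambda>i. h (e i)) c"
proof -
  interpret M: right_module R M by fact
  interpret N: right_module R N by fact
  have "h (lin_comb R M e c) = (\<Oplus>\<^bsub>N\<^esub> i \<in> {i. c i \<noteq> \<zero>\<^bsub>R\<^esub>}. h (c i \<odot>\<^bsub>M\<^esub> e i))"
    unfolding lin_comb_def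
    by (rule additive_finsum)
      (use assms c e in \<open>auto simp: mem_free_module Pi_iff M.M.abelian_group_axioms
        N.M.abelian_group_axioms intro!: M.smult_closed rmod_hom_hom\<close>)
  also have "\<dots> = lin_comb R N (\<lambda>i. h (e i)) c"
    unfolding lin_comb_def
    by (rule N.M.finsum_cong')
      (use assms c e in \<open>auto simp: mem_free_module Pi_iff rmod_homD intro!: N.smult_closed\<close>)
  finally show ?thesis .
qed

lemma lin_comb_restrict:
  assumes "right_module R M" "submodule H R M"
    and "c \<in> carrier (free_module R X)" "e \<in> X \<rightarrow> H"
  shows "lin_comb R (restrict_carrier M H) e c = lin_comb R M e c"
  using rmod_hom_lin_comb[of R "restrict_carrier M H" M "\<lambda>x. x" c X e]
    right_module.right_module_submodule[OF assms(1,2)] right_module.submoduleD(1)[OF assms(1,2)]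
    inclusion_rmod_hom[of H M R] assms by simp

lemma lin_comb_cong:
  assumes "right_module R M" "c \<in> carrier (free_module R X)" "e' \<in> X \<rightarrow> carrier M"
    and "\<And>i. i \<in> X \<Longrightarrow> e i = e' i"
  shows "lin_comb R M e c = lin_comb R M e' c"
proof -
  interpret M: right_module R M by fact
  show ?thesis
    unfolding lin_comb_def
    by (rule M.M.finsum_cong')
      (use assms in \<open>auto simp: mem_free_module Pi_iff intro!: M.smult_closed\<close>)
qed

text \<open>
  Equality in the free module can be tested coordinatewise, because evaluation at a coordinate is
  additive.
\<close>
lemma (in ring) lin_comb_free_basis:
  assumes c: "c \<in> carrier (free_module R X)" and X: "X \<subseteq> Y"
  shows "lin_comb R (free_module R Y) (free_basis R) c = c"
proof
  fix j
  interpret F: right_module R "free_module R Y" by (rule right_module_free)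
  have eval: "(\<lambda>f. f j) \<in> hom (add_monoid (free_module R Y)) (add_monoid R)"
    by (auto simp: hom_def mem_free_module)
  have "lin_comb R (free_module R Y) (free_basis R) c j =
      (\<Oplus> i \<in> {i. c i \<noteq> \<zero>}. (c i \<odot>\<^bsub>free_module R Y\<^esub> free_basis R i) j)"
    unfolding lin_comb_def
  proof (rule additive_finsum[where h = "\<lambda>f. f j"])
    show "(\<lambda>i. c i \<odot>\<^bsub>free_module R Y\<^esub> free_basis R i) \<in> {i. c i \<noteq> \<zero>} \<rightarrow> carrier (free_module R Y)"
      using c X by (intro Pi_I F.smult_closed free_basis_mem) (auto simp: mem_free_module)
  qed (use eval F.M.abelian_group_axioms abelian_group_axioms in auto)
  also have "\<dots> = (\<Oplus> i \<in> {i. c i \<noteq> \<zero>}. if j = i then c i else \<zero>)"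
    by (rule finsum_cong') (use c in \<open>auto simp: mem_free_module free_basis_def\<close>)
  also have "\<dots> = c j"
  proof (cases "c j = \<zero>")
    case True
    then have "(\<Oplus> i \<in> {i. c i \<noteq> \<zero>}. if j = i then c i else \<zero>) = (\<Oplus> i \<in> {i. c i \<noteq> \<zero>}. \<zero>)"
      by (intro finsum_cong') auto
    then show ?thesis using True by (simp add: finsum_zero)
  next
    case False
    then show ?thesis
      using c by (intro finsum_singleton) (auto simp: mem_free_module)
  qed
  finally show "lin_comb R (free_module R Y) (free_basis R) c j = c j" .
qed

section \<open>Small systems over pure submodules\<close>

lemma linear_equations_finite_support:
  "(c, m) \<in> linear_equations R H \<Longrightarrow> finite {i. c i \<noteq> \<zero>\<^bsub>R\<^esub>}"
  by (simp add: linear_equations_def)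

lemma card_of_UN_finite:
  assumes "Card_order \<kappa>" "cinfinite \<kappa>" "regularCard \<kappa>"
    and "|I| <o \<kappa>" and "\<And>i. i \<in> I \<Longrightarrow> finite (A i)"
  shows "|\<Union>i \<in> I. A i| <o \<kappa>"
proof (rule card_of_UNION_ordLess_infinite_Field_regularCard)
  have "|A i| <o \<kappa>" if "i \<in> I" for i
    using finite_ordLess_infinite2[of "A i" "Field \<kappa>"] card_of_Field_ordIso[of \<kappa>] assms that
    by (metis cinfinite_def ordLess_ordIso_trans)
  then show "\<forall>i \<in> I. |A i| <o \<kappa>" by blast
qed (use assms in auto)

lemma card_of_unknowns:
  fixes S :: "('k, 'r, 'm) equation set"
  assumes "Card_order \<kappa>" "cinfinite \<kappa>" "regularCard \<kappa>"
    and "S \<subseteq> linear_equations R H" and "|S| <o \<kappa>"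
  shows "|\<Union>(c, m) \<in> S. {i. c i \<noteq> \<zero>\<^bsub>R\<^esub>}| <o \<kappa>"
  by (rule card_of_UN_finite[OF assms(1-3,5)])
    (use assms(4) in \<open>auto dest: linear_equations_finite_support\<close>)

text \<open>
  Purity as defined speaks of unknowns named by the type on which the cardinal lives. A system of
  fewer than \<open>\<kappa>\<close> equations mentions fewer than \<open>\<kappa>\<close> unknowns, so they can be renamed injectively
  into that type. Renaming the unknowns of an equation along \<open>f\<close> is the homomorphism of free
  modules that sends the basis element of \<open>i\<close> to that of \<open>f i\<close>. The freedom in the type of
  unknowns is used below with the elements of a module as the unknowns.
\<close>
lemma solvable_in_pure_submodule:
  fixes \<kappa> :: "'l rel" and S :: "('k, 'r, 'm) equation set"
  assumes \<kappa>: "Card_order \<kappa>" "cinfinite \<kappa>" "regularCard \<kappa>"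
    and M: "right_module R M" and pure: "pure_submodule \<kappa> H R M"
    and S: "S \<subseteq> linear_equations R H" "|S| <o \<kappa>" and solv: "solvable_in R M S"
  shows "solvable_in R (restrict_carrier M H) S"
proof -
  interpret M: right_module R M by fact
  define I where "I = (\<Union>(c, m) \<in> S. {i. c i \<noteq> \<zero>\<^bsub>R\<^esub>})"
  have sub: "submodule H R M" using pure by (simp add: pure_submodule_def)
  have "|I| \<le>o |Field \<kappa>|"
    using card_of_unknowns[OF \<kappa> S] card_of_Field_ordIso[OF \<kappa>(1)] unfolding I_def
    by (meson ordLess_imp_ordLeq ordIso_symmetric ordLeq_ordIso_trans)
  then obtain f :: "'k \<Rightarrow> 'l" where f: "inj_on f I"
    unfolding card_of_ordLeq[symmetric] by blast
  let ?F = "free_module R (UNIV :: 'l set)"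
  interpret F: right_module R ?F by (rule M.R.right_module_free)
  define T where "T = (\<lambda>(c, m). (lin_comb R ?F (\<lambda>i. free_basis R (f i)) c, m)) ` S"
  have cI: "c \<in> carrier (free_module R I)" "m \<in> H" if "(c, m) \<in> S" for c m
    using that S(1) unfolding I_def by (auto simp: mem_free_module linear_equations_def)
  have basis: "(\<lambda>i. free_basis R (f i)) \<in> I \<rightarrow> carrier ?F"
    by (simp add: M.R.free_basis_mem)
  have rename: "lin_comb R M y (lin_comb R ?F (\<lambda>i. free_basis R (f i)) c) =
      lin_comb R M (\<lambda>i. y (f i)) c"
    if "c \<in> carrier (free_module R I)" "\<And>l. y l \<in> carrier M" for c y
  proof -
    have "lin_comb R M y (lin_comb R ?F (\<lambda>i. free_basis R (f i)) c) =
        lin_comb R M (\<lambda>i. lin_comb R M y (free_basis R (f i))) c"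
      by (rule rmod_hom_lin_comb[OF F.right_module_axioms M _ that(1) basis])
        (rule M.lin_comb_rmod_hom, simp add: that(2))
    then show ?thesis by (simp add: M.lin_comb_basis that(2))
  qed
  have T: "|T| <o \<kappa>" "T \<subseteq> linear_equations R H"
    unfolding T_def
    using ordLeq_ordLess_trans[OF card_of_image S(2)] cI F.lin_comb_closed[OF _ basis]
    by (auto simp: linear_equations_free)
  have "solvable_in R M T"
  proof -
    obtain x where x: "\<And>i. x i \<in> carrier M" "\<And>c m. (c, m) \<in> S \<Longrightarrow> lin_comb R M x c = m"
      using solv by (rule solvable_inE) (rule that)
    \<comment> \<open>Values outside the image of \<open>f\<close> are irrelevant, but must lie in the module.\<close>
    define x' where "x' l = (if l \<in> f ` I then x (inv_into I f l) else \<zero>\<^bsub>M\<^esub>)" for l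
    have x': "x' l \<in> carrier M" for l using x(1) by (simp add: x'_def)
    have x'f: "x' (f i) = x i" if "i \<in> I" for i using that f by (simp add: x'_def)
    have "lin_comb R M (\<lambda>i. x' (f i)) c = m" if "(c, m) \<in> S" for c m
      using lin_comb_cong[OF M cI(1)[OF that], of x "\<lambda>i. x' (f i)"] x(1) x(2)[OF that] x'f by simp
    then show ?thesis
      using cI(1) by (intro solvable_inI[of x'] x') (auto simp: T_def rename[OF _ x'])
  qed
  then have "solvable_in R (restrict_carrier M H) T"
    using pure T by (simp add: pure_submodule_def)
  then obtain y where y: "\<And>l. y l \<in> H"
    "\<And>c m. (c, m) \<in> T \<Longrightarrow> lin_comb R (restrict_carrier M H) y c = m"
    by (rule solvable_inE, unfold restrict_carrier_simps) (rule that)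
  have yM: "y l \<in> carrier M" for l using y(1) M.submoduleD(1)[OF sub] by auto
  have "lin_comb R (restrict_carrier M H) (\<lambda>i. y (f i)) c = m" if cm: "(c, m) \<in> S" for c m
  proof -
    let ?c = "lin_comb R ?F (\<lambda>i. free_basis R (f i)) c"
    have "lin_comb R (restrict_carrier M H) (\<lambda>i. y (f i)) c = lin_comb R M (\<lambda>i. y (f i)) c"
      using y(1) by (intro lin_comb_restrict[OF M sub cI(1)[OF cm]]) simp
    also have "\<dots> = lin_comb R M y ?c"
      by (rule rename[OF cI(1)[OF cm] yM, symmetric])
    also have "\<dots> = lin_comb R (restrict_carrier M H) y ?c"
      using y(1) F.lin_comb_closed[OF cI(1)[OF cm] basis]
      by (intro lin_comb_restrict[OF M sub, symmetric]) auto
    also have "\<dots> = m"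
      by (rule y(2)) (use cm in \<open>auto simp: T_def intro: rev_image_eqI\<close>)
    finally show ?thesis .
  qed
  then show ?thesis
    using y(1) by (intro solvable_inI[of "\<lambda>i. y (f i)"]) auto
qed

section \<open>The relations of a module and of a pure submodule\<close>

text \<open>The first syzygy of \<open>M\<close> when \<open>X\<close> is all of \<open>M\<close>: the relations with coefficients in \<open>R\<close> among elements of \<open>X\<close>.\<close>
definition relations :: "('r, 'c) ring_scheme \<Rightarrow> ('r, 'm) module \<Rightarrow> 'm set \<Rightarrow> ('m \<Rightarrow> 'r) set" where
  "relations R M X = {c \<in> carrier (free_module R X). lin_comb R M (\<lambda>x. x) c = \<zero>\<^bsub>M\<^esub>}"

lemma (in ring) submodule_free_module:
  assumes "X \<subseteq> Y"
  shows "submodule (carrier (free_module R X)) R (free_module R Y)"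
proof -
  interpret X: right_module R "free_module R X" by (rule right_module_free)
  interpret Y: right_module R "free_module R Y" by (rule right_module_free)
  show ?thesis
    using free_module_mono[OF assms, of R] X.M.zero_closed X.M.a_closed X.smult_closed
    by (intro Y.submoduleI) simp_all
qed

lemma (in right_module) submodule_relations:
  assumes "X \<subseteq> Y" "Y \<subseteq> carrier M"
  shows "submodule (relations R M X) R (free_module R Y)"
proof -
  interpret X: right_module R "free_module R X" by (rule R.right_module_free)
  interpret Y: right_module R "free_module R Y" by (rule R.right_module_free)
  have hom: "lin_comb R M (\<lambda>x. x) \<in> rmod_hom R (free_module R X) M"
    using assms by (intro lin_comb_rmod_hom) auto
  show ?thesis
  proof (rule Y.submoduleI)
    show "relations R M X \<subseteq> carrier (free_module R Y)"
      using free_module_mono[OF assms(1), of R] by (auto simp: relations_def)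
    show "\<zero>\<^bsub>free_module R Y\<^esub> \<in> relations R M X"
      using X.M.zero_closed
        additive_zero[OF X.M.abelian_group_axioms M.abelian_group_axioms rmod_hom_hom[OF hom]]
      by (simp add: relations_def)
    fix c c' assume "c \<in> relations R M X" "c' \<in> relations R M X"
    then show "c \<oplus>\<^bsub>free_module R Y\<^esub> c' \<in> relations R M X"
      using X.M.a_closed[of c c'] rmod_hom_add[OF hom, of c c'] by (simp add: relations_def)
  next
    fix r c assume "r \<in> carrier R" "c \<in> relations R M X"
    then show "r \<odot>\<^bsub>free_module R Y\<^esub> c \<in> relations R M X"
      using X.smult_closed[of r c] rmod_hom_smult[OF hom, of r c]
      by (simp add: relations_def smult_zero_vector)
  qed
qed

text \<open>
  The functor that sends a module to the relations among its elements preserves purity, because it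
  preserves split monomorphisms and \<open>\<kappa>\<close>-directed colimits, and \<open>\<kappa>\<close>-pure monomorphisms are such
  colimits of split ones. The proof is the elementwise form of this. "Small" means of cardinality
  less than \<open>\<kappa>\<close>. Given a small system over the relations of \<open>H\<close> and a solution \<open>x\<close> by relations of \<open>M\<close>, only a small set \<open>U\<close> of
  elements of \<open>M\<close> occurs in the solution. The statements "each \<open>x i\<close> is a relation" and "each
  element of \<open>U \<inter> H\<close> equals itself" form a small system over \<open>H\<close> whose unknowns are the
  elements of \<open>M\<close>, and it is solved tautologically in \<open>M\<close> by the elements themselves. Purity gives
  a solution \<open>y\<close> in \<open>H\<close>, that is, a substitution of elements of \<open>H\<close> for those of \<open>U\<close> which keeps
  the relations \<open>x i\<close> true and fixes \<open>U \<inter> H\<close>. Applying this substitution to the \<open>x i\<close> gives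
  relations of \<open>H\<close>, and they still solve the system since its right-hand sides involve only
  elements of \<open>U \<inter> H\<close>.
\<close>
lemma pure_submodule_relations:
  fixes \<kappa> :: "'l rel" and R :: "('r, 'c) ring_scheme" and M :: "('r, 'm) module"
  assumes \<kappa>: "Card_order \<kappa>" "cinfinite \<kappa>" "regularCard \<kappa>"
    and M: "right_module R M" and pure: "pure_submodule \<kappa> H R M"
  shows "pure_submodule \<kappa> (relations R M H) R
           (restrict_carrier (free_module R (carrier M)) (relations R M (carrier M)))"
proof -
  interpret M: right_module R M by fact
  let ?F = "free_module R (carrier M)"
  let ?K = "relations R M (carrier M)"
  let ?KH = "relations R M H"
  interpret F: right_module R ?F by (rule M.R.right_module_free)
  note F = F.right_module_axioms
  have sub: "submodule H R M" using pure by (simp add: pure_submodule_def)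
  have HM: "H \<subseteq> carrier M" by (rule M.submoduleD(1)[OF sub])
  have subK: "submodule ?K R ?F" by (rule M.submodule_relations) auto
  have subKH: "submodule ?KH R ?F" by (rule M.submodule_relations) (use HM in auto)
  have KHK: "?KH \<subseteq> ?K"
    using free_module_mono[OF HM, of R] by (auto simp: relations_def)
  show ?thesis
    unfolding pure_submodule_def submodule_restrict_iff[OF F subK KHK] restrict_carrier_simps
  proof (intro conjI subKH allI impI, elim conjE)
    fix S :: "('l, 'r, 'm \<Rightarrow> 'r) equation set"
    assume S: "S \<subseteq> linear_equations R ?KH" "|S| <o \<kappa>"
      and solv: "solvable_in R (restrict_carrier ?F ?K) S"
    define I where "I = (\<Union>(c, m) \<in> S. {i. c i \<noteq> \<zero>\<^bsub>R\<^esub>})"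
    have cI: "c \<in> carrier (free_module R I)" "m \<in> ?KH" if "(c, m) \<in> S" for c m
      using that S(1) unfolding I_def by (auto simp: mem_free_module linear_equations_def)
    obtain x where xK: "\<And>i. x i \<in> ?K"
      and xS: "\<And>c m. (c, m) \<in> S \<Longrightarrow> lin_comb R (restrict_carrier ?F ?K) x c = m"
      using solv by (rule solvable_inE, unfold restrict_carrier_simps) (rule that)
    have x: "lin_comb R ?F x c = m" if "(c, m) \<in> S" for c m
      using lin_comb_restrict[OF F subK cI(1)[OF that], of x] xK xS[OF that] by simp
    have xF: "x i \<in> carrier ?F" for i using xK[of i] by (simp add: relations_def)
    define U where "U = (\<Union>i \<in> I. {b. x i b \<noteq> \<zero>\<^bsub>R\<^esub>})"
    have card_I: "|I| <o \<kappa>"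
      unfolding I_def by (rule card_of_unknowns[OF \<kappa> S])
    then have "|U| <o \<kappa>"
      unfolding U_def by (rule card_of_UN_finite[OF \<kappa>]) (use xF in \<open>auto simp: mem_free_module\<close>)
    then have card_UH: "|U \<inter> H| <o \<kappa>"
      by (rule ordLeq_ordLess_trans[OF card_of_mono1[OF Int_lower1]])
    define T where "T = (\<lambda>i. (x i, \<zero>\<^bsub>M\<^esub>)) ` I \<union> (\<lambda>b. (free_basis R b, b)) ` (U \<inter> H)"
    have "|T| <o \<kappa>"
      unfolding T_def
      by (intro card_of_Un_ordLess_infinite_Field ordLeq_ordLess_trans[OF card_of_image])
        (use \<kappa> card_I card_UH in \<open>auto simp: cinfinite_def\<close>)
    moreover have T: "T \<subseteq> linear_equations R H"
      using xF M.R.free_basis_mem[of _ UNIV] M.submoduleD(2)[OF sub] free_module_mono[of "carrier M" UNIV R]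
      by (auto simp: T_def linear_equations_free)
    moreover have "solvable_in R M T"
    proof -
      \<comment> \<open>The tautological solution, made total.\<close>
      define z where "z b = (if b \<in> carrier M then b else \<zero>\<^bsub>M\<^esub>)" for b
      have "lin_comb R M z (x i) = \<zero>\<^bsub>M\<^esub>" for i
        using lin_comb_cong[OF M xF[of i], of "\<lambda>b. b" z] xK[of i] by (simp add: z_def relations_def)
      moreover have "lin_comb R M z (free_basis R b) = b" if "b \<in> H" for b
        using that HM by (subst M.lin_comb_basis) (auto simp: z_def)
      ultimately show ?thesis
        by (intro solvable_inI[of z]) (auto simp: z_def T_def)
    qed
    ultimately have "solvable_in R (restrict_carrier M H) T"
      using solvable_in_pure_submodule[OF \<kappa> M pure] by blast
    then obtain y where yH: "\<And>b. y b \<in> H"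
      and yT: "\<And>c m. (c, m) \<in> T \<Longrightarrow> lin_comb R (restrict_carrier M H) y c = m"
      by (rule solvable_inE, unfold restrict_carrier_simps) (rule that)
    have yM: "y b \<in> carrier M" for b using yH HM by auto
    have y: "lin_comb R M y c = m" if "(c, m) \<in> T" for c m
    proof -
      have "c \<in> carrier (free_module R UNIV)"
        using T that by (auto simp: linear_equations_free)
      then show ?thesis
        using lin_comb_restrict[OF M sub, of c UNIV y] yH yT[OF that] by simp
    qed
    have y_rel: "lin_comb R M y (x i) = \<zero>\<^bsub>M\<^esub>" if "i \<in> I" for i
      using that by (intro y) (simp add: T_def)
    have y_fix: "y b = b" if "b \<in> U \<inter> H" for b
      using y[of "free_basis R b" b] that yM M.lin_comb_basis[of y b] by (auto simp: T_def)
    \<comment> \<open>The substitution of \<open>y b\<close> for \<open>b\<close>.\<close>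
    define \<Phi> where "\<Phi> = lin_comb R ?F (\<lambda>b. free_basis R (y b))"
    have basis: "(\<lambda>b. free_basis R (y b)) \<in> X \<rightarrow> carrier (free_module R H)" for X
      using yH by (simp add: M.R.free_basis_mem)
    have basisF: "(\<lambda>b. free_basis R (y b)) \<in> X \<rightarrow> carrier ?F" for X
      using yM by (simp add: M.R.free_basis_mem)
    have \<Phi>: "\<Phi> \<in> rmod_hom R ?F ?F"
      unfolding \<Phi>_def by (rule F.lin_comb_rmod_hom[OF basisF])
    have \<Phi>H: "\<Phi> c \<in> carrier (free_module R H)" if "c \<in> carrier ?F" for c
    proof -
      interpret FH: right_module R "free_module R H" by (rule M.R.right_module_free)
      show ?thesis
        using FH.lin_comb_closed[OF that basis]
          lin_comb_restrict[OF F M.R.submodule_free_module[OF HM] that basis]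
        by (simp add: \<Phi>_def restrict_free_module)
    qed
    have \<Phi>x: "\<Phi> (x i) \<in> ?KH" if "i \<in> I" for i
    proof -
      have "lin_comb R M (\<lambda>b. b) (\<Phi> (x i)) = lin_comb R M (\<lambda>b. lin_comb R M (\<lambda>b. b) (free_basis R (y b))) (x i)"
        unfolding \<Phi>_def
        by (rule rmod_hom_lin_comb[OF F M _ xF basisF]) (rule M.lin_comb_rmod_hom, simp)
      also have "\<dots> = \<zero>\<^bsub>M\<^esub>"
        using y_rel[OF that] yM by (simp add: M.lin_comb_basis)
      finally show ?thesis
        using \<Phi>H[OF xF] by (simp add: relations_def)
    qed
    define x' where "x' i = (if i \<in> I then \<Phi> (x i) else \<zero>\<^bsub>?F\<^esub>)" for i
    have x': "x' i \<in> ?KH" for i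
      using \<Phi>x F.submoduleD(2)[OF subKH] by (simp add: x'_def)
    have "lin_comb R (restrict_carrier ?F ?KH) x' c = m" if cm: "(c, m) \<in> S" for c m
    proof -
      have "lin_comb R (restrict_carrier ?F ?KH) x' c = lin_comb R ?F x' c"
        using x' by (intro lin_comb_restrict[OF F subKH cI(1)[OF cm]]) auto
      also have "\<dots> = lin_comb R ?F (\<lambda>i. \<Phi> (x i)) c"
        using rmod_hom_closed[OF \<Phi>] xF
        by (intro lin_comb_cong[OF F cI(1)[OF cm]]) (auto simp: x'_def)
      also have "\<dots> = \<Phi> (lin_comb R ?F x c)"
        using xF by (intro rmod_hom_lin_comb[OF F F \<Phi> cI(1)[OF cm], symmetric]) auto
      also have "\<dots> = \<Phi> m" using x[OF cm] by simp
      also have "\<dots> = lin_comb R ?F (free_basis R) m"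
      proof -
        have UM: "U \<subseteq> carrier M" using xF by (auto simp: U_def mem_free_module)
        \<comment> \<open>\<open>m\<close> is a combination of the \<open>x i\<close>, hence supported in \<open>U\<close>; the substitution fixes it.\<close>
        interpret FU: right_module R "free_module R U" by (rule M.R.right_module_free)
        have "x \<in> I \<rightarrow> carrier (free_module R U)"
          using xF by (auto simp: U_def mem_free_module)
        then have "lin_comb R ?F x c \<in> carrier (free_module R U)"
          using FU.lin_comb_closed[OF cI(1)[OF cm], of x]
            lin_comb_restrict[OF F M.R.submodule_free_module[OF UM] cI(1)[OF cm], of x]
          by (simp add: restrict_free_module)
        then have "m \<in> carrier (free_module R (U \<inter> H))"
          using x[OF cm] cI(2)[OF cm] by (auto simp: relations_def mem_free_module)
        then show ?thesis
          unfolding \<Phi>_def using HM y_fix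
          by (intro lin_comb_cong[OF F]) (auto intro: M.R.free_basis_mem)
      qed
      also have "\<dots> = m"
        using cI(2)[OF cm] by (intro M.R.lin_comb_free_basis[OF _ HM]) (simp add: relations_def)
      finally show ?thesis .
    qed
    then show "solvable_in R (restrict_carrier ?F ?KH) S"
      using x' by (intro solvable_inI[of x']) auto
  qed
qed

section \<open>Gluing and factoring homomorphisms\<close>

text \<open>The module \<open>L\<close> is the sum \<open>H + K\<close>.\<close>
lemma rmod_hom_glue:
  assumes M: "right_module R M" and N: "right_module R N"
    and H: "submodule H R M" and K: "submodule K R M"
    and f: "f \<in> rmod_hom R (restrict_carrier M H) N"
    and g: "g \<in> rmod_hom R (restrict_carrier M K) N"
    and agree: "\<And>x. \<lbrakk>x \<in> H; x \<in> K\<rbrakk> \<Longrightarrow> f x = g x"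
  obtains L h where "submodule L R M" "H \<subseteq> L" "K \<subseteq> L" "h \<in> rmod_hom R (restrict_carrier M L) N"
    "\<And>x. x \<in> H \<Longrightarrow> h x = f x" "\<And>x. x \<in> K \<Longrightarrow> h x = g x"
proof -
  interpret M: right_module R M by fact
  interpret N: right_module R N by fact
  interpret MH: right_module R "restrict_carrier M H" by (rule M.right_module_submodule[OF H])
  interpret MK: right_module R "restrict_carrier M K" by (rule M.right_module_submodule[OF K])
  note subH = M.submoduleD[OF H] and subK = M.submoduleD[OF K]
  note fD = rmod_homD[OF f, simplified] and gD = rmod_homD[OF g, simplified]
  have HM: "x \<in> carrier M" if "x \<in> H" for x using subH(1) that by auto
  have KM: "x \<in> carrier M" if "x \<in> K" for x using subK(1) that by auto
  have f0: "f \<zero>\<^bsub>M\<^esub> = \<zero>\<^bsub>N\<^esub>" and g0: "g \<zero>\<^bsub>M\<^esub> = \<zero>\<^bsub>N\<^esub>"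
    using additive_zero[OF MH.M.abelian_group_axioms N.M.abelian_group_axioms rmod_hom_hom[OF f]]
      additive_zero[OF MK.M.abelian_group_axioms N.M.abelian_group_axioms rmod_hom_hom[OF g]]
    by simp_all
  have well_defined: "f x \<oplus>\<^bsub>N\<^esub> g y = f x' \<oplus>\<^bsub>N\<^esub> g y'"
    if "x \<in> H" "y \<in> K" "x' \<in> H" "y' \<in> K" and eq: "x \<oplus>\<^bsub>M\<^esub> y = x' \<oplus>\<^bsub>M\<^esub> y'" for x y x' y'
  proof -
    note in_M = HM[OF that(1)] KM[OF that(2)] HM[OF that(3)] KM[OF that(4)]
    \<comment> \<open>\<open>x - x' = y' - y\<close> lies in both submodules, where \<open>f\<close> and \<open>g\<close> agree.\<close>
    define w where "w = x \<oplus>\<^bsub>M\<^esub> \<ominus>\<^bsub>M\<^esub> x'"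
    have minus: "\<ominus>\<^bsub>M\<^esub> x' \<in> H" "\<ominus>\<^bsub>M\<^esub> y \<in> K"
      using subH(4)[of "\<ominus>\<^bsub>R\<^esub> \<one>\<^bsub>R\<^esub>" x'] subK(4)[of "\<ominus>\<^bsub>R\<^esub> \<one>\<^bsub>R\<^esub>" y] in_M that
      by (simp_all add: M.minus_one_smult)
    have wM: "w \<in> carrier M" using in_M by (simp add: w_def)
    have x: "x = w \<oplus>\<^bsub>M\<^esub> x'" using in_M by (simp add: w_def M.M.a_assoc M.M.l_neg)
    then have "x' \<oplus>\<^bsub>M\<^esub> (w \<oplus>\<^bsub>M\<^esub> y) = x' \<oplus>\<^bsub>M\<^esub> y'"
      using eq in_M wM by (simp add: M.M.a_ac)
    then have y': "w \<oplus>\<^bsub>M\<^esub> y = y'" using in_M wM by simp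
    then have "w = y' \<oplus>\<^bsub>M\<^esub> \<ominus>\<^bsub>M\<^esub> y" using in_M wM by (auto simp: M.M.a_assoc M.M.r_neg)
    then have w: "w \<in> H" "w \<in> K"
      using that minus subH(3)[of x "\<ominus>\<^bsub>M\<^esub> x'"] subK(3)[of y' "\<ominus>\<^bsub>M\<^esub> y"] by (auto simp: w_def)
    have "f x = g w \<oplus>\<^bsub>N\<^esub> f x'" "g y' = g w \<oplus>\<^bsub>N\<^esub> g y"
      using fD(2)[OF w(1) that(3)] gD(2)[OF w(2) that(2)] x y' agree[OF w] by simp_all
    then show ?thesis
      using fD(1) gD(1) w that by (simp add: N.M.a_ac)
  qed
  define L where "L = {x \<oplus>\<^bsub>M\<^esub> y | x y. x \<in> H \<and> y \<in> K}"
  define h where "h z = (SOME v. \<exists>x \<in> H. \<exists>y \<in> K. z = x \<oplus>\<^bsub>M\<^esub> y \<and> v = f x \<oplus>\<^bsub>N\<^esub> g y)" for z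
  have h: "h (x \<oplus>\<^bsub>M\<^esub> y) = f x \<oplus>\<^bsub>N\<^esub> g y" if "x \<in> H" "y \<in> K" for x y
  proof -
    have "\<exists>x' \<in> H. \<exists>y' \<in> K. x \<oplus>\<^bsub>M\<^esub> y = x' \<oplus>\<^bsub>M\<^esub> y' \<and> h (x \<oplus>\<^bsub>M\<^esub> y) = f x' \<oplus>\<^bsub>N\<^esub> g y'"
      unfolding h_def by (rule someI_ex) (use that in blast)
    then show ?thesis using well_defined[OF that] by metis
  qed
  have add: "(x \<oplus>\<^bsub>M\<^esub> y) \<oplus>\<^bsub>M\<^esub> (x' \<oplus>\<^bsub>M\<^esub> y') = (x \<oplus>\<^bsub>M\<^esub> x') \<oplus>\<^bsub>M\<^esub> (y \<oplus>\<^bsub>M\<^esub> y')"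
    if "x \<in> H" "y \<in> K" "x' \<in> H" "y' \<in> K" for x y x' y'
    using HM[OF that(1)] KM[OF that(2)] HM[OF that(3)] KM[OF that(4)] by (simp add: M.M.a_ac)
  have smult: "r \<odot>\<^bsub>M\<^esub> (x \<oplus>\<^bsub>M\<^esub> y) = r \<odot>\<^bsub>M\<^esub> x \<oplus>\<^bsub>M\<^esub> r \<odot>\<^bsub>M\<^esub> y"
    if "x \<in> H" "y \<in> K" "r \<in> carrier R" for r x y
    using HM[OF that(1)] KM[OF that(2)] that(3) by (simp add: M.smult_add_vector)
  show thesis
  proof (rule that)
    show sub: "H \<subseteq> L"
    proof
      fix x assume "x \<in> H"
      then show "x \<in> L"
        unfolding L_def using subK(2) HM by (intro CollectI exI[of _ x] exI[of _ "\<zero>\<^bsub>M\<^esub>"]) simp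
    qed
    show "K \<subseteq> L"
    proof
      fix x assume "x \<in> K"
      then show "x \<in> L"
        unfolding L_def using subH(2) KM by (intro CollectI exI[of _ "\<zero>\<^bsub>M\<^esub>"] exI[of _ x]) simp
    qed
    show "submodule L R M"
    proof (rule M.submoduleI)
      show "L \<subseteq> carrier M" using HM KM by (auto simp: L_def)
      show "\<zero>\<^bsub>M\<^esub> \<in> L" using sub subH(2) by auto
    next
      fix u v assume "u \<in> L" "v \<in> L"
      then obtain x y x' y' where uv: "x \<in> H" "y \<in> K" "x' \<in> H" "y' \<in> K"
        "u = x \<oplus>\<^bsub>M\<^esub> y" "v = x' \<oplus>\<^bsub>M\<^esub> y'"
        unfolding L_def by blast
      then show "u \<oplus>\<^bsub>M\<^esub> v \<in> L"
        using add[OF uv(1-4)] subH(3)[OF uv(1,3)] subK(3)[OF uv(2,4)] by (auto simp: L_def)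
    next
      fix r u assume r: "r \<in> carrier R" and "u \<in> L"
      then obtain x y where u: "x \<in> H" "y \<in> K" "u = x \<oplus>\<^bsub>M\<^esub> y" unfolding L_def by blast
      then show "r \<odot>\<^bsub>M\<^esub> u \<in> L"
        using smult[OF u(1,2) r] subH(4)[OF r u(1)] subK(4)[OF r u(2)] by (auto simp: L_def)
    qed
    show "h \<in> rmod_hom R (restrict_carrier M L) N"
    proof (rule rmod_homI, unfold restrict_carrier_simps)
      fix u assume "u \<in> L"
      then obtain x y where u: "x \<in> H" "y \<in> K" "u = x \<oplus>\<^bsub>M\<^esub> y" unfolding L_def by blast
      then show "h u \<in> carrier N" using h fD(1) gD(1) by simp
      fix r assume r: "r \<in> carrier R"
      show "h (r \<odot>\<^bsub>M\<^esub> u) = r \<odot>\<^bsub>N\<^esub> h u"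
        using u r subH(4)[OF r u(1)] subK(4)[OF r u(2)] fD(1,3) gD(1,3)
        by (simp add: smult h N.smult_add_vector)
    next
      fix u v assume "u \<in> L" "v \<in> L"
      then obtain x y x' y' where uv: "x \<in> H" "y \<in> K" "x' \<in> H" "y' \<in> K"
        "u = x \<oplus>\<^bsub>M\<^esub> y" "v = x' \<oplus>\<^bsub>M\<^esub> y'"
        unfolding L_def by blast
      then show "h (u \<oplus>\<^bsub>M\<^esub> v) = h u \<oplus>\<^bsub>N\<^esub> h v"
        using subH(3)[OF uv(1,3)] subK(3)[OF uv(2,4)] fD(1,2) gD(1,2)
        by (simp add: add h N.M.a_ac)
    qed
    show "h x = f x" if "x \<in> H" for x
      using h[OF that subK(2)] HM[OF that] fD(1)[OF that] g0 by simp
    show "h x = g x" if "x \<in> K" for x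
      using h[OF subH(2) that] KM[OF that] gD(1)[OF that] f0 by simp
  qed
qed

lemma rmod_hom_factor:
  assumes M: "right_module R M" and N: "right_module R N" and L: "right_module R L"
    and p: "p \<in> rmod_hom R M N" "p ` carrier M = carrier N"
    and f: "f \<in> rmod_hom R M L"
    and ker: "\<And>x. \<lbrakk>x \<in> carrier M; p x = \<zero>\<^bsub>N\<^esub>\<rbrakk> \<Longrightarrow> f x = \<zero>\<^bsub>L\<^esub>"
  obtains g where "g \<in> rmod_hom R N L" "\<And>x. x \<in> carrier M \<Longrightarrow> g (p x) = f x"
proof -
  interpret M: right_module R M by fact
  interpret N: right_module R N by fact
  interpret L: right_module R L by fact
  note pD = rmod_homD[OF p(1)] and fD = rmod_homD[OF f]
  have well_defined: "f x = f y" if "x \<in> carrier M" "y \<in> carrier M" "p x = p y" for x y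
  proof -
    define w where "w = x \<oplus>\<^bsub>M\<^esub> \<ominus>\<^bsub>M\<^esub> y"
    have w: "w \<in> carrier M" "x = w \<oplus>\<^bsub>M\<^esub> y"
      using that by (simp_all add: w_def M.M.a_assoc M.M.l_neg)
    then have "p w \<oplus>\<^bsub>N\<^esub> p y = \<zero>\<^bsub>N\<^esub> \<oplus>\<^bsub>N\<^esub> p y"
      using pD(1,2) that by simp
    then have "p w = \<zero>\<^bsub>N\<^esub>"
      using pD(1) w that by (subst (asm) N.M.add.right_cancel) simp_all
    then show ?thesis
      using ker[OF w(1)] w fD(1,2) that by simp
  qed
  define g where "g y = f (inv_into (carrier M) p y)" for y
  have g: "g (p x) = f x" if "x \<in> carrier M" for x
    unfolding g_def using that
    by (intro well_defined inv_into_into f_inv_into_f) auto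
  have lift: "\<exists>x \<in> carrier M. y = p x" if "y \<in> carrier N" for y
    using that p(2) by blast
  have "g \<in> rmod_hom R N L"
  proof (rule rmod_homI)
    fix y assume "y \<in> carrier N"
    then obtain x where x: "x \<in> carrier M" "y = p x" using lift by blast
    then show "g y \<in> carrier L" using g fD(1) by simp
    show "g (r \<odot>\<^bsub>N\<^esub> y) = r \<odot>\<^bsub>L\<^esub> g y" if r: "r \<in> carrier R" for r
      using x r g[OF M.smult_closed[OF r x(1)]] g[OF x(1)] pD(3) fD(3) by simp
  next
    fix y y' assume "y \<in> carrier N" "y' \<in> carrier N"
    then obtain x x' where x: "x \<in> carrier M" "y = p x" "x' \<in> carrier M" "y' = p x'"
      using lift by meson
    then show "g (y \<oplus>\<^bsub>N\<^esub> y') = g y \<oplus>\<^bsub>L\<^esub> g y'"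
      using g[OF M.M.a_closed[OF x(1,3)]] g pD(2) fD(2) by simp
  qed
  then show thesis using g by (rule that)
qed

section \<open>Test modules on other types\<close>

text \<open>
  Injectivity and pure-injectivity are tested on modules over one fixed type. The test modules that
  arise in the proof live on function types; they are isomorphic to modules on the given type by
  transport of structure along an injection of their carriers.
\<close>
definition transported_module :: "('m \<Rightarrow> 'v) \<Rightarrow> ('r, 'm) module \<Rightarrow> ('r, 'v) module" where
  "transported_module j M = (let pre = inv_into (carrier M) j in \<lparr>
     carrier = j ` carrier M, mult = undefined, one = undefined,
     ring.zero = j \<zero>\<^bsub>M\<^esub>, add = (\<lambda>x y. j (pre x \<oplus>\<^bsub>M\<^esub> pre y)),
     smult = (\<lambda>r x. j (r \<odot>\<^bsub>M\<^esub> pre x))\<rparr>)"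

lemma transported_module_simps:
  "carrier (transported_module j M) = j ` carrier M"
  "\<zero>\<^bsub>transported_module j M\<^esub> = j \<zero>\<^bsub>M\<^esub>"
  "\<lbrakk>inj_on j (carrier M); x \<in> carrier M; y \<in> carrier M\<rbrakk> \<Longrightarrow>
     j x \<oplus>\<^bsub>transported_module j M\<^esub> j y = j (x \<oplus>\<^bsub>M\<^esub> y)"
  "\<lbrakk>inj_on j (carrier M); x \<in> carrier M\<rbrakk> \<Longrightarrow>
     r \<odot>\<^bsub>transported_module j M\<^esub> j x = j (r \<odot>\<^bsub>M\<^esub> x)"
  by (simp_all add: transported_module_def Let_def)

lemma right_module_transported:
  assumes M: "right_module R M" and j: "inj_on j (carrier M)"
  shows "right_module R (transported_module j M)"
proof -
  interpret M: right_module R M by fact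
  note simps = transported_module_simps transported_module_simps(3,4)[OF j]
  let ?M = "transported_module j M"
  have "abelian_group ?M"
  proof (rule abelian_groupI)
    fix x assume "x \<in> carrier ?M"
    then obtain u where u: "u \<in> carrier M" "x = j u" by (auto simp: simps)
    then show "\<exists>y \<in> carrier ?M. y \<oplus>\<^bsub>?M\<^esub> x = \<zero>\<^bsub>?M\<^esub>"
      by (intro bexI[of _ "j (\<ominus>\<^bsub>M\<^esub> u)"]) (simp_all add: simps M.M.l_neg)
  qed (auto simp: simps M.M.a_ac)
  moreover have "right_module_axioms R ?M"
  proof
  qed (auto simp: simps M.smult_closed M.smult_add_scalar M.smult_add_vector M.smult_assoc
      M.smult_one)
  ultimately show ?thesis
    by (simp add: right_module_def M.R.ring_axioms)
qed

lemma transport_rmod_hom: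
  assumes "inj_on j (carrier M)"
  shows "j \<in> rmod_hom R M (transported_module j M)"
  by (rule rmod_homI) (simp_all add: transported_module_simps assms)

lemma transport_inv_rmod_hom:
  assumes M: "right_module R M" and j: "inj_on j (carrier M)"
  shows "inv_into (carrier M) j \<in> rmod_hom R (transported_module j M) M"
proof -
  interpret M: right_module R M by fact
  show ?thesis
    by (rule rmod_homI) (auto simp: transported_module_simps j M.smult_closed)
qed

lemma submodule_transported:
  assumes M: "right_module R M" and j: "inj_on j (carrier M)" and H: "submodule H R M"
  shows "submodule (j ` H) R (transported_module j M)"
proof -
  interpret M: right_module R M by fact
  interpret T: right_module R "transported_module j M" by (rule right_module_transported[OF M j])
  note sub = M.submoduleD[OF H]
  have HM: "x \<in> carrier M" if "x \<in> H" for x using sub(1) that by auto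
  show ?thesis
    by (rule T.submoduleI)
      (use sub in \<open>auto simp: transported_module_simps HM j\<close>)
qed

lemma pure_submodule_transported:
  fixes R :: "('r, 'c) ring_scheme" and M :: "('r, 'm) module"
    and j :: "'m \<Rightarrow> 'v" and \<kappa> :: "'l rel"
  assumes M: "right_module R M" and j: "inj_on j (carrier M)" and pure: "pure_submodule \<kappa> H R M"
  shows "pure_submodule \<kappa> (j ` H) R (transported_module j M)"
proof -
  interpret M: right_module R M by fact
  let ?M = "transported_module j M" and ?inv = "inv_into (carrier M) j"
  have T: "right_module R ?M" by (rule right_module_transported[OF M j])
  have H: "submodule H R M" using pure by (simp add: pure_submodule_def)
  note sub = M.submoduleD[OF H]
  have jH: "submodule (j ` H) R ?M" by (rule submodule_transported[OF M j H])
  have HM: "x \<in> carrier M" if "x \<in> H" for x using sub(1) that by auto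
  have inv_j: "?inv (j x) = x" if "x \<in> H" for x using that HM j by simp
  show ?thesis
    unfolding pure_submodule_def
  proof (intro conjI allI impI jH, elim conjE)
    fix S :: "('l, 'r, 'v) equation set"
    assume S: "S \<subseteq> linear_equations R (j ` H)" "|S| <o \<kappa>" and solv: "solvable_in R ?M S"
    have coeffs: "c \<in> carrier (free_module R UNIV)" "m \<in> j ` H" if "(c, m) \<in> S" for c m
      using S(1) that by (auto simp: linear_equations_free)
    define S' where "S' = (\<lambda>(c, m). (c, ?inv m)) ` S"
    have "|S'| <o \<kappa>"
      unfolding S'_def by (rule ordLeq_ordLess_trans[OF card_of_image S(2)])
    moreover have "S' \<subseteq> linear_equations R H"
      using coeffs inv_j by (fastforce simp: S'_def linear_equations_free)
    moreover have "solvable_in R M S'"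
    proof -
      obtain x where x: "\<And>i. x i \<in> carrier ?M" "\<And>c m. (c, m) \<in> S \<Longrightarrow> lin_comb R ?M x c = m"
        using solv by (rule solvable_inE) (rule that)
      have hom: "?inv \<in> rmod_hom R ?M M" by (rule transport_inv_rmod_hom[OF M j])
      have "lin_comb R M (\<lambda>i. ?inv (x i)) c = ?inv m" if "(c, m) \<in> S" for c m
        using rmod_hom_lin_comb[OF T M hom coeffs(1)[OF that], of x] x(1) x(2)[OF that] by simp
      then show ?thesis
        using rmod_hom_closed[OF hom x(1)] by (intro solvable_inI[of "\<lambda>i. ?inv (x i)"]) (auto simp: S'_def)
    qed
    ultimately have "solvable_in R (restrict_carrier M H) S'"
      using pure by (simp add: pure_submodule_def)
    then obtain y where y: "\<And>l. y l \<in> H"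
      "\<And>c m. (c, m) \<in> S' \<Longrightarrow> lin_comb R (restrict_carrier M H) y c = m"
      by (rule solvable_inE, unfold restrict_carrier_simps) (rule that)
    have "lin_comb R (restrict_carrier ?M (j ` H)) (\<lambda>i. j (y i)) c = m" if cm: "(c, m) \<in> S" for c m
    proof -
      have "(c, ?inv m) \<in> S'" using cm by (auto simp: S'_def intro: rev_image_eqI)
      then have "lin_comb R M y c = ?inv m"
        using y(2) lin_comb_restrict[OF M H coeffs(1)[OF cm], of y] y(1) by auto
      moreover have "j (lin_comb R M y c) = lin_comb R ?M (\<lambda>i. j (y i)) c"
        by (rule rmod_hom_lin_comb[OF M T transport_rmod_hom[OF j] coeffs(1)[OF cm]])
          (use y(1) HM in auto)
      moreover have "lin_comb R (restrict_carrier ?M (j ` H)) (\<lambda>i. j (y i)) c =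
          lin_comb R ?M (\<lambda>i. j (y i)) c"
        by (rule lin_comb_restrict[OF T jH coeffs(1)[OF cm]]) (use y(1) in auto)
      moreover have "j (?inv m) = m" using coeffs(2)[OF cm] inv_j by auto
      ultimately show ?thesis by simp
    qed
    then show "solvable_in R (restrict_carrier ?M (j ` H)) S"
      using y(1) by (intro solvable_inI[of "\<lambda>i. j (y i)"]) auto
  qed
qed

lemma extends_homs_transported:
  assumes M: "right_module R M" and j: "inj_on j (carrier M)" and H: "submodule H R M"
    and ext: "extends_homs R F (j ` H) (transported_module j M)"
  shows "extends_homs R F H M"
  unfolding extends_homs_def
proof
  fix f assume f: "f \<in> rmod_hom R (restrict_carrier M H) F"
  interpret M: right_module R M by fact
  let ?M = "transported_module j M" and ?inv = "inv_into (carrier M) j"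
  have HM: "H \<subseteq> carrier M" by (rule M.submoduleD(1)[OF H])
  have inv_j: "?inv (j x) = x" if "x \<in> H" for x using that HM j by (auto intro: inv_into_f_f)
  have "?inv \<in> rmod_hom R (restrict_carrier ?M (j ` H)) (restrict_carrier M H)"
    using transport_inv_rmod_hom[OF M j] HM inv_j
    by (intro rmod_hom_corestrict rmod_hom_restrict) (auto simp: transported_module_simps)
  from bspec[OF ext[unfolded extends_homs_def] rmod_hom_comp[OF this f]]
  obtain g where g: "g \<in> rmod_hom R ?M F" "\<forall>x \<in> j ` H. g x = f (?inv x)"
    by (rule bexE)
  show "\<exists>g \<in> rmod_hom R M F. \<forall>x \<in> H. g x = f x"
    using rmod_hom_comp[OF transport_rmod_hom[OF j] g(1)] g(2) inv_j
    by (intro bexI[of _ "\<lambda>x. g (j x)"]) auto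
qed

lemma injective_module_extends_homs:
  fixes j :: "'m \<Rightarrow> 'v"
  assumes "injective_module TYPE('v) R F" and M: "right_module R M" "submodule H R M"
    and j: "inj_on j (carrier M)"
  shows "extends_homs R F H M"
  using assms right_module_transported[OF M(1) j] submodule_transported[OF M(1) j M(2)]
  by (intro extends_homs_transported[OF M(1) j M(2)]) (simp add: injective_module_def)

lemma pure_injective_module_extends_homs:
  fixes j :: "'m \<Rightarrow> 'v"
  assumes "pure_injective_module TYPE('v) \<kappa> R F" and M: "right_module R M" "pure_submodule \<kappa> H R M"
    and j: "inj_on j (carrier M)"
  shows "extends_homs R F H M"
  using assms right_module_transported[OF M(1) j] pure_submodule_transported[OF M(1) j M(2)]
  by (intro extends_homs_transported[OF M(1) j])
    (simp_all add: pure_injective_module_def pure_submodule_def[of \<kappa> H])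

section \<open>Cokernels in injective modules\<close>

lemma submodule_image:
  assumes M: "right_module R M" and N: "right_module R N" and h: "h \<in> rmod_hom R M N"
  shows "submodule (h ` carrier M) R N"
proof -
  interpret M: right_module R M by fact
  interpret N: right_module R N by fact
  note hD = rmod_homD[OF h]
  have "\<zero>\<^bsub>N\<^esub> = h \<zero>\<^bsub>M\<^esub>"
    using additive_zero[OF M.M.abelian_group_axioms N.M.abelian_group_axioms hD(4)] by simp
  then show ?thesis
    by (intro N.submoduleI)
      (auto simp: hD(1) hD(2,3)[symmetric] M.smult_closed intro!: imageI)
qed

text \<open>
  Let \<open>f\<close> be a homomorphism to \<open>Q\<close> from a pure submodule \<open>H\<close> of \<open>M\<close>. Since free modules are
  projective, \<open>f\<close> lifts to a homomorphism \<open>h\<close> from the free module on \<open>H\<close> to \<open>E\<close>, and \<open>h\<close> maps the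
  relations of \<open>H\<close> to \<open>P\<close>. These are pure in the relations of \<open>M\<close>, so that restriction of \<open>h\<close>
  extends to a homomorphism \<open>k\<close> from the relations of \<open>M\<close> to \<open>P\<close>. Now \<open>h\<close> and \<open>k\<close> agree where both
  are defined in the free module on \<open>M\<close>, and by injectivity of \<open>E\<close> they have a common extension \<open>l\<close>
  to all of it. As \<open>l\<close> sends the relations of \<open>M\<close> to \<open>P\<close>, its composite with \<open>d\<close> factors through
  \<open>M\<close>, and the resulting homomorphism extends \<open>f\<close>. In homological terms, the surjectivity of
  \<open>Ext\<^sup>1(M, P) \<rightarrow> Ext\<^sup>1(H, P)\<close> carries the proof. The injection \<open>code\<close> lets the free modules serve as
  test modules.
\<close>
lemma pure_injective_cokernel:
  fixes R :: "('r, 'c) ring_scheme" and \<kappa> :: "'l rel" and code :: "('v \<Rightarrow> 'r) \<Rightarrow> 'v"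
    and P :: "('r, 'p) module" and E :: "('r, 'e) module" and Q :: "('r, 'q) module"
  assumes \<kappa>: "Card_order \<kappa>" "cinfinite \<kappa>" "regularCard \<kappa>"
    and P: "pure_injective_module TYPE('v) \<kappa> R P"
    and E: "injective_module TYPE('v) R E" and Q: "right_module R Q"
    and \<iota>: "\<iota> \<in> rmod_hom R P E" "inj_on \<iota> (carrier P)"
    and d: "d \<in> rmod_hom R E Q" "d ` carrier E = carrier Q"
    and exact: "\<iota> ` carrier P = {x \<in> carrier E. d x = \<zero>\<^bsub>Q\<^esub>}"
    and code: "inj_on code (carrier (free_module R UNIV))"
  shows "pure_injective_module TYPE('v) \<kappa> R Q"
  unfolding pure_injective_module_def extends_homs_def
proof (intro conjI Q allI impI ballI, elim conjE)
  fix M :: "('r, 'v) module" and H f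
  assume M: "right_module R M" and pure: "pure_submodule \<kappa> H R M"
    and f: "f \<in> rmod_hom R (restrict_carrier M H) Q"
  have Pm: "right_module R P" using P by (simp add: pure_injective_module_def)
  have Em: "right_module R E" using E by (simp add: injective_module_def)
  interpret M: right_module R M by fact
  interpret P: right_module R P by fact
  interpret E: right_module R E by fact
  let ?F = "free_module R (carrier M)" and ?FH = "free_module R H"
  let ?K = "relations R M (carrier M)" and ?KH = "relations R M H"
  let ?\<pi> = "lin_comb R M (\<lambda>b. b)"
  have H: "submodule H R M" using pure by (simp add: pure_submodule_def)
  have HM: "H \<subseteq> carrier M" by (rule M.submoduleD(1)[OF H])
  have MH: "right_module R (restrict_carrier M H)" by (rule M.right_module_submodule[OF H])
  interpret F: right_module R ?F by (rule M.R.right_module_free)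
  note F = F.right_module_axioms
  have subK: "submodule ?K R ?F" by (rule M.submodule_relations) auto
  have subFH: "submodule (carrier ?FH) R ?F" by (rule M.R.submodule_free_module[OF HM])
  have \<pi>: "?\<pi> \<in> rmod_hom R ?F M" by (rule M.lin_comb_rmod_hom) simp
  define e where "e b = inv_into (carrier E) d (f b)" for b
  have fQ: "f b \<in> d ` carrier E" if "b \<in> H" for b
    using rmod_hom_closed[OF f, of b] that d(2) by simp
  have eE: "e b \<in> carrier E" and de: "d (e b) = f b" if "b \<in> H" for b
    using fQ[OF that] by (simp_all add: e_def inv_into_into f_inv_into_f)
  have e: "e \<in> H \<rightarrow> carrier E" using eE by simp
  define h where "h = lin_comb R E e"
  have h: "h \<in> rmod_hom R ?FH E" unfolding h_def by (rule E.lin_comb_rmod_hom[OF e])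
  have dh: "d (h c) = f (?\<pi> c)" if c: "c \<in> carrier ?FH" for c
  proof -
    have "d (h c) = lin_comb R Q (\<lambda>b. d (e b)) c"
      unfolding h_def by (rule rmod_hom_lin_comb[OF Em Q d(1) c e])
    also have "\<dots> = lin_comb R Q f c"
      using de rmod_hom_closed[OF f] by (intro lin_comb_cong[OF Q c]) auto
    also have "\<dots> = f (lin_comb R (restrict_carrier M H) (\<lambda>b. b) c)"
      by (rule rmod_hom_lin_comb[OF MH Q f c, symmetric]) simp
    also have "\<dots> = f (?\<pi> c)"
      by (subst lin_comb_restrict[OF M H c]) simp_all
    finally show ?thesis .
  qed
  have f0: "f \<zero>\<^bsub>M\<^esub> = \<zero>\<^bsub>Q\<^esub>"
    using additive_zero[OF right_module.axioms(2)[OF MH] right_module.axioms(2)[OF Q] rmod_hom_hom[OF f]]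
    by simp
  let ?I = "restrict_carrier E (\<iota> ` carrier P)"
  have I: "right_module R ?I"
    by (rule E.right_module_submodule[OF submodule_image[OF Pm Em \<iota>(1)]])
  \<comment> \<open>The inverse of \<open>\<iota>\<close> on its image, by which \<open>h\<close> is regarded as a map to \<open>P\<close>.\<close>
  obtain s where s: "s \<in> rmod_hom R ?I P" "\<And>x. x \<in> carrier P \<Longrightarrow> s (\<iota> x) = x"
  proof (rule rmod_hom_factor[OF Pm I Pm])
    show "\<iota> \<in> rmod_hom R P ?I" by (rule rmod_hom_corestrict[OF \<iota>(1)]) simp
    show "(\<lambda>x. x) \<in> rmod_hom R P P" by (rule rmod_homI) simp_all
    have "\<iota> \<zero>\<^bsub>P\<^esub> = \<zero>\<^bsub>E\<^esub>"
      by (rule additive_zero[OF P.M.abelian_group_axioms E.M.abelian_group_axioms rmod_hom_hom[OF \<iota>(1)]])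
    then show "x = \<zero>\<^bsub>P\<^esub>" if "x \<in> carrier P" "\<iota> x = \<zero>\<^bsub>?I\<^esub>" for x
      using that inj_onD[OF \<iota>(2), of x "\<zero>\<^bsub>P\<^esub>"] by simp
  qed simp_all
  have hK: "h c \<in> \<iota> ` carrier P" if "c \<in> ?KH" for c
    using that dh[of c] f0 rmod_hom_closed[OF h, of c] unfolding exact relations_def by simp
  have "h \<in> rmod_hom R (restrict_carrier ?FH ?KH) E"
    by (rule rmod_hom_restrict[OF h]) (auto simp: relations_def)
  then have "h \<in> rmod_hom R (restrict_carrier ?FH ?KH) ?I"
    by (rule rmod_hom_corestrict) (use hK in auto)
  from rmod_hom_comp[OF this s(1)]
  have sh: "(\<lambda>c. s (h c)) \<in> rmod_hom R (restrict_carrier ?F ?KH) P"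
    by (simp add: restrict_carrier_def free_module_def)
  have code': "inj_on code (carrier (restrict_carrier ?F ?K))"
    by (rule inj_on_subset[OF code]) (auto simp: relations_def mem_free_module)
  have "extends_homs R P ?KH (restrict_carrier ?F ?K)"
    by (rule pure_injective_module_extends_homs[OF P F.right_module_submodule[OF subK]
          pure_submodule_relations[OF \<kappa> M pure] code'])
  then obtain k where k: "k \<in> rmod_hom R (restrict_carrier ?F ?K) P"
    "\<forall>c \<in> ?KH. k c = s (h c)"
    using sh unfolding extends_homs_def restrict_carrier_simps by (blast dest: bspec)
  have \<iota>k: "(\<lambda>c. \<iota> (k c)) \<in> rmod_hom R (restrict_carrier ?F ?K) E"
    by (rule rmod_hom_comp[OF k(1) \<iota>(1)])
  have agree: "h c = \<iota> (k c)" if "c \<in> carrier ?FH" "c \<in> ?K" for c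
  proof -
    have c: "c \<in> ?KH" using that by (simp add: relations_def)
    then show ?thesis using hK[OF c] k(2) s(2) by auto
  qed
  have h': "h \<in> rmod_hom R (restrict_carrier ?F (carrier ?FH)) E"
    using h by (simp add: restrict_free_module)
  obtain L l' where L: "submodule L R ?F" "carrier ?FH \<subseteq> L" "?K \<subseteq> L"
    and l': "l' \<in> rmod_hom R (restrict_carrier ?F L) E"
      "\<And>c. c \<in> carrier ?FH \<Longrightarrow> l' c = h c" "\<And>c. c \<in> ?K \<Longrightarrow> l' c = \<iota> (k c)"
    using rmod_hom_glue[OF F Em subFH subK h' \<iota>k agree] by blast
  have "inj_on code (carrier ?F)"
    by (rule inj_on_subset[OF code]) (auto simp: mem_free_module)
  from injective_module_extends_homs[OF E F L(1) this]
  obtain l where l: "l \<in> rmod_hom R ?F E" "\<forall>c \<in> L. l c = l' c"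
    using l'(1) unfolding extends_homs_def by (blast dest: bspec)
  have lH: "l c = h c" if "c \<in> carrier ?FH" for c
    using l(2) l'(2)[OF that] L(2) that by auto
  have lK: "l c = \<iota> (k c)" if "c \<in> ?K" for c
    using l(2) l'(3)[OF that] L(3) that by auto
  have basis: "?\<pi> (free_basis R b) = b" if "b \<in> carrier M" for b
    using M.lin_comb_basis[of "\<lambda>b. b" b] that by simp
  have \<pi>_surj: "?\<pi> ` carrier ?F = carrier M"
  proof
    show "carrier M \<subseteq> ?\<pi> ` carrier ?F"
      using basis M.R.free_basis_mem by (metis image_eqI subsetI)
  qed (use rmod_hom_closed[OF \<pi>] in auto)
  have dl: "d (l c) = \<zero>\<^bsub>Q\<^esub>" if "c \<in> carrier ?F" "?\<pi> c = \<zero>\<^bsub>M\<^esub>" for c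
  proof -
    have c: "c \<in> ?K" using that by (simp add: relations_def)
    then have "\<iota> (k c) \<in> \<iota> ` carrier P" using rmod_hom_closed[OF k(1), of c] by simp
    then show ?thesis using exact lK[OF c] by simp
  qed
  obtain g where g: "g \<in> rmod_hom R M Q" "\<And>c. c \<in> carrier ?F \<Longrightarrow> g (?\<pi> c) = d (l c)"
    by (rule rmod_hom_factor[OF F M Q \<pi> \<pi>_surj rmod_hom_comp[OF l(1) d(1)]])
      (rule dl that, assumption+)+
  have "g b = f b" if b: "b \<in> H" for b
  proof -
    have bH: "free_basis R b \<in> carrier ?FH" and bF: "free_basis R b \<in> carrier ?F"
      using b HM by (auto intro: M.R.free_basis_mem)
    have "g b = d (h (free_basis R b))"
      using g(2)[OF bF] basis[of b] b HM lH[OF bH] by auto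
    also have "\<dots> = f b" using dh[OF bH] basis[of b] b HM by auto
    finally show ?thesis .
  qed
  then show "\<exists>g \<in> rmod_hom R M Q. \<forall>x \<in> H. g x = f x"
    using g(1) by blast
qed

text \<open>
  The graph of the function over its support is a finite set of pairs, and an infinite set is
  equipotent to the set of finite subsets of its square.
\<close>
lemma finite_support_code:
  fixes i :: "'r \<Rightarrow> 'v"
  assumes inf: "infinite (UNIV :: 'v set)" and i: "inj i"
  obtains code :: "('v \<Rightarrow> 'r) \<Rightarrow> 'v" where "inj_on code {c. finite {b. c b \<noteq> z}}"
proof -
  define graph where "graph c = (\<lambda>b. (b, i (c b))) ` {b. c b \<noteq> z}" for c :: "'v \<Rightarrow> 'r"
  have inf2: "infinite (UNIV :: ('v \<times> 'v) set)"
    using inf by (simp add: finite_prod)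
  have "|Fpow (UNIV :: ('v \<times> 'v) set)| =o |UNIV :: ('v \<times> 'v) set|"
    using inf2 by simp
  also have "|UNIV :: ('v \<times> 'v) set| =o |UNIV :: 'v set|"
    using card_of_Times_same_infinite[OF inf] by simp
  finally obtain t :: "('v \<times> 'v) set \<Rightarrow> 'v" where t: "inj_on t (Fpow UNIV)"
    by (metis bij_betw_def card_of_ordIso)
  have "inj_on graph {c. finite {b. c b \<noteq> z}}"
  proof (rule inj_onI, rule ext)
    fix c c' b assume "graph c = graph c'"
    then have "(b, v) \<in> graph c \<longleftrightarrow> (b, v) \<in> graph c'" for v by simp
    then have "c b \<noteq> z \<and> v = i (c b) \<longleftrightarrow> c' b \<noteq> z \<and> v = i (c' b)" for v
      by (auto simp: graph_def)
    then show "c b = c' b" using i by (metis injD)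
  qed
  moreover have "graph ` {c. finite {b. c b \<noteq> z}} \<subseteq> Fpow UNIV"
    by (auto simp: graph_def Fpow_def)
  ultimately have "inj_on (t \<circ> graph) {c. finite {b. c b \<noteq> z}}"
    using t by (blast intro: comp_inj_on inj_on_subset)
  then show thesis by (rule that)
qed

section \<open>Cosyzygy modules\<close>

theorem proposition4p5:
  fixes R :: "('r, 'c) ring_scheme"
    and \<kappa> :: "'l rel"
    and P :: "('r, 'p) module"
    and E :: "nat \<Rightarrow> ('r, 'e) module"
    and \<iota> :: "'p \<Rightarrow> 'e"
    and d :: "nat \<Rightarrow> 'e \<Rightarrow> 'e"
    and n :: nat
  assumes "ring R"
    and "Card_order \<kappa>" and "cinfinite \<kappa>" and "regularCard \<kappa>"
    and "pure_injective_module TYPE(('u, 'r, 'e) test_type) \<kappa> R P"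
    and "injective_coresolution TYPE(('u, 'r, 'e) test_type) R P \<iota> E d"
  shows "pure_injective_module TYPE('u) \<kappa> R (cosyzygy E d n)"
proof -
  let ?V = "TYPE(('u, 'r, 'e) test_type)"
  note \<kappa> = assms(2-4)
  have inj_E: "injective_module ?V R (E m)" and d: "d m \<in> rmod_hom R (E m) (E (Suc m))"
    and ker_d: "d m ` carrier (E m) = {x \<in> carrier (E (Suc m)). d (Suc m) x = \<zero>\<^bsub>E (Suc (Suc m))\<^esub>}"
    for m
    using assms(6) by (auto simp: injective_coresolution_def a_kernel_def')
  have \<iota>: "\<iota> \<in> rmod_hom R P (E 0)" "inj_on \<iota> (carrier P)"
    and ker_\<iota>: "\<iota> ` carrier P = {x \<in> carrier (E 0). d 0 x = \<zero>\<^bsub>E (Suc 0)\<^esub>}"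
    using assms(6) by (auto simp: injective_coresolution_def a_kernel_def')
  have E: "right_module R (E m)" for m using inj_E by (simp add: injective_module_def)
  have cosyzygy: "right_module R (cosyzygy E d m)" "carrier (cosyzygy E d m) = d m ` carrier (E m)"
    "\<zero>\<^bsub>cosyzygy E d m\<^esub> = \<zero>\<^bsub>E (Suc m)\<^esub>" "d m \<in> rmod_hom R (E m) (cosyzygy E d m)" for m
    unfolding cosyzygy_def
    using right_module.right_module_submodule[OF E submodule_image[OF E E d]]
      rmod_hom_corestrict[OF d, of m "d m ` carrier (E m)"] by simp_all
  obtain code :: "(('u, 'r, 'e) test_type \<Rightarrow> 'r) \<Rightarrow> ('u, 'r, 'e) test_type"
    where "inj_on code {c. finite {b. c b \<noteq> \<zero>\<^bsub>R\<^esub>}}"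
    by (rule finite_support_code[of "\<lambda>r. [Inr (Inl r)]"]) (auto simp: infinite_UNIV_listI inj_def)
  then have code: "inj_on code (carrier (free_module R UNIV))"
    by (rule inj_on_subset) (auto simp: mem_free_module)
  \<comment> \<open>The induction has to stay on the large type, which is closed under forming free modules.\<close>
  have "pure_injective_module ?V \<kappa> R (cosyzygy E d n)"
  proof (induction n)
    case 0
    show ?case
      by (rule pure_injective_cokernel[OF \<kappa> assms(5) inj_E cosyzygy(1) \<iota> cosyzygy(4) _ _ code])
        (simp_all add: cosyzygy(2,3) ker_\<iota>)
  next
    case (Suc n)
    have "(\<lambda>x. x) \<in> rmod_hom R (cosyzygy E d n) (E (Suc n))"
      unfolding cosyzygy_def by (rule inclusion_rmod_hom) (use rmod_hom_closed[OF d] in auto)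
    then show ?case
      by (rule pure_injective_cokernel[OF \<kappa> Suc.IH inj_E cosyzygy(1) _ _ cosyzygy(4) _ _ code])
        (simp_all add: cosyzygy(2,3) ker_d)
  qed
  moreover have "inj (\<lambda>u. [Inl u] :: ('u, 'r, 'e) test_type)" by (simp add: inj_def)
  ultimately show ?thesis
    unfolding pure_injective_module_def[of "TYPE('u)"]
    using cosyzygy(1) by (blast intro: pure_injective_module_extends_homs inj_on_subset)
qed

end
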